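(* Let $H$ be a polarized rational Hodge structure of weight $2$ with $H^{2,0}\neq0$, with polarization form $\langle\,,\rangle$, endowed with an associative unital $\mathbb{Q}$-algebra structure such that the product $H\otimes H\to H$ is a morphism of Hodge structures of bidegree $(-1,-1)$, and such that there is an involutive endomorphism $t:H\to H$ with $\langle ax,y\rangle=\langle x,t(a)y\rangle$ and $\langle xa,y\rangle=\langle x,yt(a)\rangle$ for all $a,x,y\in H$. Assume that the $t$-invariant part of the center of $H$ is a number field $K^+$. Then there exists a polarized weight $1$ Hodge structure on $H$ such that the multiplication on the left $$H\to \mathrm{Hom}(H,H)$$ is a morphism of weight $2$ Hodge structures, where the weight $2$ Hodge structure on the left is the initial one, and the weight $2$ Hodge structure on the right is induced by the weight $1$ Hodge structure on $H$.
   Context: A polarized rational Hodge structure of weight $2$ is a finite-dimensional $\mathbb{Q}$-vector space $H$ with a decomposition $H_{\mathbb{C}}:=H\otimes\mathbb{C}=H^{2,0}\oplus H^{1,1}\oplus H^{0,2}$, $\overline{H^{2,0}}=H^{0,2}$, $\overline{H^{1,1}}=H^{1,1}$, and a rational symmetric bilinear form $\langle\,,\rangle$ such that the decomposition is orthogonal for $h(\alpha,\beta)=\langle\alpha,\overline{\beta}\rangle$, with $h$ positive definite on $H^{2,0}$ and $H^{0,2}$ and negative definite on $H^{1,1}$. The product, $\langle\,,\rangle$ and $t$ are extended $\mathbb{C}$-(bi)linearly to $H_{\mathbb{C}}$. Bidegree $(-1,-1)$ means $H^{p,q}\cdot H^{r,s}\subset H^{p+r-1,q+s-1}$, with $H^{p,q}=0$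 unless $(p,q)\in\{(2,0),(1,1),(0,2)\}$. A (rational) weight $1$ Hodge structure on $H$ is a decomposition $H_{\mathbb{C}}=W'\oplus\overline{W'}$, with $W'$ the $(1,0)$-part; it is polarized by a rational skew-symmetric bilinear form $\omega$ on $H$ if $W'$ is totally isotropic for $\omega$ and $(w,w')\mapsto i\omega(w,\overline{w'})$ is positive definite on $W'$. The induced weight $2$ Hodge structure on $\mathrm{Hom}(H,H)$ has $(2,0)$-part $\mathrm{Hom}(\overline{W'},W')$, $(1,1)$-part $\mathrm{End}(W')\oplus\mathrm{End}(\overline{W'})$, $(0,2)$-part $\mathrm{Hom}(W',\overline{W'})$. *)

theory Defs
  imports Complex_Main
begin

class rat_vector = ab_group_add +
  fixes scaleQ :: "rat \<Rightarrow> 'a \<Rightarrow> 'a" (infixr \<open>*\<^sub>Q\<close> 75)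
  assumes scaleQ_add_right: "q *\<^sub>Q (x + y) = q *\<^sub>Q x + q *\<^sub>Q y"
    and scaleQ_add_left: "(q + r) *\<^sub>Q x = q *\<^sub>Q x + r *\<^sub>Q x"
    and scaleQ_scaleQ: "q *\<^sub>Q (r *\<^sub>Q x) = (q * r) *\<^sub>Q x"
    and scaleQ_one: "1 *\<^sub>Q x = x"

class rat_algebra_1 = ring_1 + rat_vector +
  assumes mult_scaleQ_left: "(q *\<^sub>Q x) * y = q *\<^sub>Q (x * y)"
    and mult_scaleQ_right: "x * (q *\<^sub>Q y) = q *\<^sub>Q (x * y)"

global_interpretation Qvec: vector_space "scaleQ :: rat \<Rightarrow> 'a::rat_vector \<Rightarrow> 'a"
  by unfold_locales
    (simp_all add: scaleQ_add_right scaleQ_add_left scaleQ_scaleQ scaleQ_one)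

definition Q_functional :: "('h::rat_vector \<Rightarrow> complex) \<Rightarrow> bool" where
  "Q_functional \<phi> \<longleftrightarrow>
     (\<forall>x y. \<phi> (x + y) = \<phi> x + \<phi> y) \<and> (\<forall>q x. \<phi> (q *\<^sub>Q x) = of_rat q * \<phi> x)"

definition Q_bilinear_form :: "('h::rat_vector \<Rightarrow> 'h \<Rightarrow> rat) \<Rightarrow> bool" where
  "Q_bilinear_form \<beta> \<longleftrightarrow>
     (\<forall>x. Vector_Spaces.linear scaleQ (*) (\<beta> x)) \<and>
     (\<forall>y. Vector_Spaces.linear scaleQ (*) (\<lambda>x. \<beta> x y))"

text \<open>
  The tensor product of \<open>H\<close> with the complex numbers over the rationals. A list
  \<open>[(x\<^sub>1,c\<^sub>1),\<dots>,(x\<^sub>n,c\<^sub>n)]\<close> stands for the sum of the elementary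
  tensors \<open>x\<^sub>i \<otimes> c\<^sub>i\<close>. The rational-linear maps \<open>\<phi>\<close> from \<open>H\<close> to the complex
  numbers, extended by \<open>x \<otimes> c \<mapsto> c * \<phi> x\<close>, separate the points of the tensor product
  (in any dimension), so two sums are the same tensor exactly if all these maps agree on them.
\<close>

definition eval_tensor :: "('h::rat_vector \<Rightarrow> complex) \<Rightarrow> ('h \<times> complex) list \<Rightarrow> complex" where
  "eval_tensor \<phi> xs = (\<Sum>(x, c)\<leftarrow>xs. c * \<phi> x)"

definition tensor_eq :: "('h::rat_vector \<times> complex) list \<Rightarrow> ('h \<times> complex) list \<Rightarrow> bool" where
  "tensor_eq xs ys \<longleftrightarrow> (\<forall>\<phi>. Q_functional \<phi> \<longrightarrow> eval_tensor \<phi> xs = eval_tensor \<phi> ys)"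

quotient_type (overloaded) 'h complexification = "('h::rat_vector \<times> complex) list" / tensor_eq
  by (rule equivpI) (auto simp: tensor_eq_def reflp_def symp_def transp_def)

lemma eval_tensor_simps [simp]:
  "eval_tensor \<phi> [] = 0"
  "eval_tensor \<phi> ((x, c) # xs) = c * \<phi> x + eval_tensor \<phi> xs"
  "eval_tensor \<phi> (xs @ ys) = eval_tensor \<phi> xs + eval_tensor \<phi> ys"
  by (simp_all add: eval_tensor_def)

lemma eval_tensor_scale:
  "eval_tensor \<phi> (map (\<lambda>(x, d). (x, c * d)) xs) = c * eval_tensor \<phi> xs"
  by (induction xs) (auto simp: algebra_simps)

lemma eval_tensor_cnj:
  "eval_tensor \<phi> (map (\<lambda>(x, d). (x, cnj d)) xs) = cnj (eval_tensor (\<lambda>x. cnj (\<phi> x)) xs)"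
  by (induction xs) auto

lemma Q_functional_cnj: "Q_functional \<phi> \<Longrightarrow> Q_functional (\<lambda>x. cnj (\<phi> x))"
proof -
  have "cnj (of_rat q) = of_rat q" for q
    by (cases q) (simp add: of_rat_rat)
  then show "Q_functional \<phi> \<Longrightarrow> Q_functional (\<lambda>x. cnj (\<phi> x))"
    by (simp add: Q_functional_def)
qed

lemma Q_functional_eval_tensor:
  assumes "\<And>y. Q_functional (\<lambda>x. \<beta> x y)"
  shows "Q_functional (\<lambda>x. eval_tensor (\<beta> x) ys)"
proof (induction ys)
  case Nil
  show ?case by (simp add: Q_functional_def)
next
  case (Cons p ys)
  then show ?case using assms[of "fst p"]
    by (cases p) (auto simp: Q_functional_def algebra_simps)
qed

lift_definition tensor :: "'h::rat_vector \<Rightarrow> complex \<Rightarrow> 'h complexification" (infix \<open>\<otimes>\<^sub>C\<close> 76)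
  is "\<lambda>x c. [(x, c)]" .

instantiation complexification :: (rat_vector) ab_group_add
begin

lift_definition zero_complexification :: "'a complexification" is "[]" .

lift_definition plus_complexification ::
  "'a complexification \<Rightarrow> 'a complexification \<Rightarrow> 'a complexification" is "(@)"
  by (simp add: tensor_eq_def)

lift_definition uminus_complexification :: "'a complexification \<Rightarrow> 'a complexification"
  is "map (\<lambda>(x, c). (x, (-1) * c))"
  unfolding tensor_eq_def eval_tensor_scale by simp

lift_definition minus_complexification ::
  "'a complexification \<Rightarrow> 'a complexification \<Rightarrow> 'a complexification"
  is "\<lambda>xs ys. xs @ map (\<lambda>(x, c). (x, (-1) * c)) ys"
  unfolding tensor_eq_def eval_tensor_simps eval_tensor_scale by simp

instance
proof
  fix a b c :: "'a complexification"
  show "a + b + c = a + (b + c)"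
    by transfer (simp add: tensor_eq_def)
  show "a + b = b + a"
    by transfer (simp add: tensor_eq_def)
  show "0 + a = a"
    by transfer (simp add: tensor_eq_def)
  show "- a + a = 0"
    by transfer (simp only: tensor_eq_def eval_tensor_simps eval_tensor_scale, simp)
  show "a - b = a + - b"
    by transfer (simp add: tensor_eq_def)
qed

end

lift_definition scaleC :: "complex \<Rightarrow> 'h::rat_vector complexification \<Rightarrow> 'h complexification"
  (infixr \<open>*\<^sub>C\<close> 75) is "\<lambda>c. map (\<lambda>(x, d). (x, c * d))"
  unfolding tensor_eq_def eval_tensor_scale by simp

global_interpretation Cvec:
  vector_space "scaleC :: complex \<Rightarrow> 'h::rat_vector complexification \<Rightarrow> 'h complexification"
proof
  fix c d :: complex and v w :: "'h complexification"
  show "c *\<^sub>C (v + w) = c *\<^sub>C v + c *\<^sub>C w"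
    by transfer (simp add: tensor_eq_def)
  show "(c + d) *\<^sub>C v = c *\<^sub>C v + d *\<^sub>C v"
    by transfer (simp only: tensor_eq_def eval_tensor_simps eval_tensor_scale, simp add: distrib_right)
  show "c *\<^sub>C d *\<^sub>C v = (c * d) *\<^sub>C v"
    by transfer (simp only: tensor_eq_def eval_tensor_scale, simp)
  show "1 *\<^sub>C v = v"
    by transfer (simp only: tensor_eq_def eval_tensor_scale, simp)
qed

lift_definition conjugate :: "'h::rat_vector complexification \<Rightarrow> 'h complexification"
  is "map (\<lambda>(x, d). (x, cnj d))"
  unfolding tensor_eq_def eval_tensor_cnj by (simp add: Q_functional_cnj)

text \<open>The complex-bilinear extension of a rational bilinear form (and \<open>0\<close> for a map
  that is not bilinear).\<close>

lift_definition extend_form ::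
  "('h::rat_vector \<Rightarrow> 'h \<Rightarrow> rat) \<Rightarrow> 'h complexification \<Rightarrow> 'h complexification \<Rightarrow> complex"
  is "\<lambda>\<beta> xs ys. if Q_bilinear_form \<beta>
        then (\<Sum>(x, c)\<leftarrow>xs. \<Sum>(y, d)\<leftarrow>ys. c * d * of_rat (\<beta> x y)) else 0"
proof -
  fix \<beta> :: "'h \<Rightarrow> 'h \<Rightarrow> rat" and xs xs' ys ys' :: "('h \<times> complex) list"
  assume xs: "tensor_eq xs xs'" and ys: "tensor_eq ys ys'"
  have eq: "(\<Sum>(x, c)\<leftarrow>us. \<Sum>(y, d)\<leftarrow>vs. c * d * of_rat (\<beta> x y))
    = eval_tensor (\<lambda>x. eval_tensor (\<lambda>y. of_rat (\<beta> x y)) vs) us"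
    for us vs :: "('h \<times> complex) list"
    by (simp add: eval_tensor_def sum_list_const_mult[symmetric] split_def mult.assoc)
  {
    assume \<beta>: "Q_bilinear_form \<beta>"
    have r: "Q_functional (\<lambda>y. of_rat (\<beta> x y))" and l: "Q_functional (\<lambda>y. of_rat (\<beta> y x))" for x
      using \<beta> by (auto simp: Q_bilinear_form_def Q_functional_def Vector_Spaces.linear_iff of_rat_add of_rat_mult)
    have "Q_functional (\<lambda>x. eval_tensor (\<lambda>y. of_rat (\<beta> x y)) ys')"
      by (rule Q_functional_eval_tensor) (rule l)
    then have "eval_tensor (\<lambda>x. eval_tensor (\<lambda>y. of_rat (\<beta> x y)) ys) xs
      = eval_tensor (\<lambda>x. eval_tensor (\<lambda>y. of_rat (\<beta> x y)) ys') xs'"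
      using xs ys r by (simp add: tensor_eq_def)
  }
  then show "(if Q_bilinear_form \<beta>
        then (\<Sum>(x, c)\<leftarrow>xs. \<Sum>(y, d)\<leftarrow>ys. c * d * of_rat (\<beta> x y)) else 0)
     = (if Q_bilinear_form \<beta>
        then (\<Sum>(x, c)\<leftarrow>xs'. \<Sum>(y, d)\<leftarrow>ys'. c * d * of_rat (\<beta> x y)) else 0)"
    unfolding eq by simp
qed

lemma eval_tensor_mult:
  "eval_tensor \<phi> (concat (map (\<lambda>(x, c). map (\<lambda>(y, d). (x * y, c * d)) ys) xs))
    = eval_tensor (\<lambda>x. eval_tensor (\<lambda>y. \<phi> (x * y)) ys) xs"
proof -
  have "eval_tensor \<phi> (map (\<lambda>(y, d). (x * y, c * d)) ys)
      = c * eval_tensor (\<lambda>y. \<phi> (x * y)) ys" for x c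
    by (induction ys) (auto simp: algebra_simps)
  then show ?thesis
    by (induction xs) auto
qed

lemma Q_functional_mult:
  fixes \<phi> :: "'h::rat_algebra_1 \<Rightarrow> complex"
  assumes "Q_functional \<phi>"
  shows "Q_functional (\<lambda>x. \<phi> (x * y))" "Q_functional (\<lambda>y. \<phi> (x * y))"
  using assms
  by (simp_all add: Q_functional_def mult_scaleQ_left mult_scaleQ_right distrib_left distrib_right)

lemma eval_tensor_add:
  "eval_tensor (\<lambda>x. \<phi> x + \<psi> x) xs = eval_tensor \<phi> xs + eval_tensor \<psi> xs"
  by (induction xs) (auto simp: algebra_simps)

lemma Q_functional_nonzero_exists:
  fixes a :: "'h::rat_vector"
  assumes "a \<noteq> 0"
  shows "\<exists>\<phi>. Q_functional \<phi> \<and> \<phi> a \<noteq> 0"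
proof -
  interpret vector_space_pair "scaleQ :: rat \<Rightarrow> 'h \<Rightarrow> 'h" "\<lambda>q z. of_rat q * z :: complex"
    by unfold_locales (simp_all add: algebra_simps of_rat_add of_rat_mult)
  have "Qvec.independent {a}"
    using assms by (simp add: Qvec.independent_insert)
  from linear_independent_extend[OF this, of "\<lambda>_. 1"]
  obtain g where "Vector_Spaces.linear scaleQ (\<lambda>q z. of_rat q * z :: complex) g" "g a = 1"
    by auto
  then show ?thesis
    by (intro exI[of _ g]) (simp add: Q_functional_def Vector_Spaces.linear_iff)
qed

instantiation complexification :: (rat_algebra_1) ring_1
begin

lift_definition one_complexification :: "'a complexification" is "[(1, 1)]" .

lift_definition times_complexification ::
  "'a complexification \<Rightarrow> 'a complexification \<Rightarrow> 'a complexification"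
  is "\<lambda>xs ys. concat (map (\<lambda>(x, c). map (\<lambda>(y, d). (x * y, c * d)) ys) xs)"
proof -
  fix xs xs' ys ys' :: "('a \<times> complex) list"
  assume xs: "tensor_eq xs xs'" and ys: "tensor_eq ys ys'"
  show "tensor_eq (concat (map (\<lambda>(x, c). map (\<lambda>(y, d). (x * y, c * d)) ys) xs))
                  (concat (map (\<lambda>(x, c). map (\<lambda>(y, d). (x * y, c * d)) ys') xs'))"
    unfolding tensor_eq_def eval_tensor_mult
  proof (intro allI impI)
    fix \<phi> :: "'a \<Rightarrow> complex"
    assume \<phi>: "Q_functional \<phi>"
    have "Q_functional (\<lambda>x. eval_tensor (\<lambda>y. \<phi> (x * y)) ys')"
      by (rule Q_functional_eval_tensor) (rule Q_functional_mult(1)[OF \<phi>])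
    then show "eval_tensor (\<lambda>x. eval_tensor (\<lambda>y. \<phi> (x * y)) ys) xs
             = eval_tensor (\<lambda>x. eval_tensor (\<lambda>y. \<phi> (x * y)) ys') xs'"
      using xs ys Q_functional_mult(2)[OF \<phi>] by (simp add: tensor_eq_def)
  qed
qed

instance
proof
  fix u v w :: "'a complexification"
  show "u * v * w = u * (v * w)"
    by transfer (simp add: tensor_eq_def eval_tensor_mult mult.assoc)
  show "1 * u = u" "u * 1 = u"
    by (transfer, simp only: tensor_eq_def eval_tensor_mult eval_tensor_simps, simp)+
  show "(u + v) * w = u * w + v * w" "u * (v + w) = u * v + u * w"
    by (transfer, simp only: tensor_eq_def eval_tensor_mult eval_tensor_simps eval_tensor_add, simp)+
  show "(0::'a complexification) \<noteq> 1"
    by transfer (use Q_functional_nonzero_exists[of "1::'a"] in \<open>auto simp: tensor_eq_def\<close>)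
qed

end

lemma tensor_times_tensor: "(x \<otimes>\<^sub>C c) * (y \<otimes>\<^sub>C d) = (x * y) \<otimes>\<^sub>C (c * d)"
  by transfer (simp add: tensor_eq_def)

text \<open>A weight 2 Hodge structure is given by the family of its components \<open>X p q\<close>, which
  are zero unless \<open>(p, q)\<close> is one of \<open>(2, 0)\<close>, \<open>(1, 1)\<close>, \<open>(0, 2)\<close>.\<close>

definition hodge_structure_2 ::
  "(int \<Rightarrow> int \<Rightarrow> 'h::rat_vector complexification set) \<Rightarrow> bool" where
  "hodge_structure_2 X \<longleftrightarrow>
     (\<forall>p q. Cvec.subspace (X p q)) \<and>
     (\<forall>p q. (p, q) \<notin> {(2, 0), (1, 1), (0, 2)} \<longrightarrow> X p q = {0}) \<and>
     (\<forall>v. \<exists>!(a, b, c). a \<in> X 2 0 \<and> b \<in> X 1 1 \<and> c \<in> X 0 2 \<and> v = a + b + c) \<and>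
     conjugate ` X 2 0 = X 0 2 \<and> conjugate ` X 1 1 = X 1 1"

definition hermitian_form ::
  "('h::rat_vector \<Rightarrow> 'h \<Rightarrow> rat) \<Rightarrow> 'h complexification \<Rightarrow> 'h complexification \<Rightarrow> complex" where
  "hermitian_form \<beta> v w = extend_form \<beta> v (conjugate w)"

definition positive_definite_on :: "'v::zero set \<Rightarrow> ('v \<Rightarrow> 'v \<Rightarrow> complex) \<Rightarrow> bool" where
  "positive_definite_on S h \<longleftrightarrow> (\<forall>v\<in>S. v \<noteq> 0 \<longrightarrow> h v v \<in> \<real> \<and> Re (h v v) > 0)"

definition polarizes_2 ::
  "(int \<Rightarrow> int \<Rightarrow> 'h::rat_vector complexification set) \<Rightarrow> ('h \<Rightarrow> 'h \<Rightarrow> rat) \<Rightarrow> bool" where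
  "polarizes_2 X \<beta> \<longleftrightarrow>
     Q_bilinear_form \<beta> \<and> (\<forall>x y. \<beta> x y = \<beta> y x) \<and>
     (\<forall>p q r s. (p, q) \<noteq> (r, s) \<longrightarrow> (\<forall>v\<in>X p q. \<forall>w\<in>X r s. hermitian_form \<beta> v w = 0)) \<and>
     positive_definite_on (X 2 0) (hermitian_form \<beta>) \<and>
     positive_definite_on (X 0 2) (hermitian_form \<beta>) \<and>
     positive_definite_on (X 1 1) (\<lambda>v w. - hermitian_form \<beta> v w)"

text \<open>A weight 1 Hodge structure is given by its (1,0)-part \<open>W\<close>.\<close>

definition hodge_structure_1 :: "'h::rat_vector complexification set \<Rightarrow> bool" where
  "hodge_structure_1 W \<longleftrightarrow>
     Cvec.subspace W \<and> (\<forall>v. \<exists>!(a, b). a \<in> W \<and> b \<in> conjugate ` W \<and> v = a + b)"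

definition polarizes_1 ::
  "'h::rat_vector complexification set \<Rightarrow> ('h \<Rightarrow> 'h \<Rightarrow> rat) \<Rightarrow> bool" where
  "polarizes_1 W \<omega> \<longleftrightarrow>
     Q_bilinear_form \<omega> \<and> (\<forall>x y. \<omega> x y = - \<omega> y x) \<and>
     (\<forall>v\<in>W. \<forall>w\<in>W. extend_form \<omega> v w = 0) \<and>
     positive_definite_on W (\<lambda>v w. \<i> * hermitian_form \<omega> v w)"

text \<open>
  The weight 2 Hodge structure on \<open>Hom(H, H)\<close> induced by \<open>W\<close>. For finite-dimensional \<open>H\<close> the
  complexification of \<open>Hom(H, H)\<close> is the space of complex-linear endomorphisms of the
  complexification of \<open>H\<close>; a map between two of the summands \<open>W\<close> and \<open>conjugate ` W\<close> is regarded
  as an endomorphism that vanishes on the other summand.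
\<close>

definition Hom_hodge ::
  "'h::rat_vector complexification set \<Rightarrow> int \<Rightarrow> int \<Rightarrow>
     ('h complexification \<Rightarrow> 'h complexification) set" where
  "Hom_hodge W p q = {f. Vector_Spaces.linear scaleC scaleC f \<and>
     (if (p, q) = (2, 0) then f ` (conjugate ` W) \<subseteq> W \<and> f ` W \<subseteq> {0}
      else if (p, q) = (1, 1) then f ` W \<subseteq> W \<and> f ` (conjugate ` W) \<subseteq> conjugate ` W
      else if (p, q) = (0, 2) then f ` W \<subseteq> conjugate ` W \<and> f ` (conjugate ` W) \<subseteq> {0}
      else f = (\<lambda>_. 0))}"

definition product_has_bidegree_minus_one ::
  "(int \<Rightarrow> int \<Rightarrow> 'h::rat_algebra_1 complexification set) \<Rightarrow> bool" where
  "product_has_bidegree_minus_one X \<longleftrightarrow>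
     (\<forall>p q r s. \<forall>v\<in>X p q. \<forall>w\<in>X r s. v * w \<in> X (p + r - 1) (q + s - 1))"

text \<open>The complex-linear extension of \<open>a \<mapsto> (x \<mapsto> a * x)\<close> is left multiplication on the
  complexification.\<close>

definition left_mult_hodge_morphism ::
  "(int \<Rightarrow> int \<Rightarrow> 'h::rat_algebra_1 complexification set) \<Rightarrow> 'h complexification set \<Rightarrow> bool" where
  "left_mult_hodge_morphism X W \<longleftrightarrow> (\<forall>p q. \<forall>v\<in>X p q. (\<lambda>w. v * w) \<in> Hom_hodge W p q)"

definition number_field :: "'h::rat_algebra_1 set \<Rightarrow> bool" where
  "number_field K \<longleftrightarrow>
     Qvec.subspace K \<and> (\<exists>B. finite B \<and> K = Qvec.span B) \<and>
     1 \<in> K \<and> (\<forall>x\<in>K. \<forall>y\<in>K. x * y \<in> K \<and> x * y = y * x) \<and>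
     (\<forall>x\<in>K. x \<noteq> 0 \<longrightarrow> (\<exists>y\<in>K. x * y = 1))"

definition center :: "'h::ring_1 set" where
  "center = {z. \<forall>x. z * x = x * z}"

end

theory Submission
  imports Defs "HOL-Computational_Algebra.Fundamental_Theorem_Algebra"
begin

text \<open>
  The complexification \<open>A\<close> of \<open>H\<close> is a graded algebra with degrees \<open>1, 0, -1\<close>. Correcting the
  hermitian form by the Weil operator makes it positive definite; left and right multiplications then
  have adjoints given, up to sign, by the involution \<open>hat v = conjugate (t v)\<close>. Projecting \<open>1\<close>
  orthogonally to the span of the products of \<open>(2,0)\<close>- with \<open>(0,2)\<close>-elements gives an idempotent
  \<open>p\<close> with \<open>p a = a\<close>, \<open>a p = 0\<close> for \<open>a\<close> of degree \<open>1\<close>, and \<open>u = p + conjugate p\<close> is a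
  nonzero central idempotent, which splits off the trivially graded ideal \<open>S = {v. u v = 0}\<close>.
  On the complement of \<open>S\<close> the \<open>(1,0)\<close>-part is the right ideal \<open>p A\<close>. There the Weil operator is
  right multiplication by \<open>- (p - conjugate p)\<close>. As \<open>- \<i> (p - conjugate p)\<close> is real and
  anti-invariant under \<open>t\<close>, it is close to a rational \<open>s\<close> with \<open>t s = - s\<close>, and then
  \<open>\<omega> x y = form x (y s)\<close> polarizes \<open>p A\<close>. Right multiplication by \<open>s\<close> is injective: if
  \<open>x s = 0\<close> for a rational \<open>x\<close> then \<open>u x = 0\<close>, and since \<open>u\<close> lies in the complexification of the
  field \<open>K\<^sup>+\<close>, some nonzero element of \<open>K\<^sup>+\<close> kills \<open>x\<close>. Hence on \<open>S\<close> the self-adjoint operator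
  \<open>v \<mapsto> \<i> v s\<close> has no kernel, and the span \<open>P\<close> of its eigenvectors with positive eigenvalue
  is the missing piece: \<open>W = p A + P\<close>.
\<close>

section \<open>Finite-dimensional hermitian spaces\<close>

locale hermitian_space = vector_space scale
  for scale :: "complex \<Rightarrow> 'v::ab_group_add \<Rightarrow> 'v" (infixr \<open>*s\<close> 75) +
  fixes ip :: "'v \<Rightarrow> 'v \<Rightarrow> complex"
  assumes ip_add_left: "ip (v + w) x = ip v x + ip w x"
    and ip_scale_left: "ip (c *s v) x = c * ip v x"
    and ip_cnj: "cnj (ip v w) = ip w v"
    and ip_pos: "v \<noteq> 0 \<Longrightarrow> 0 < Re (ip v v)"
    and finite_dim: "\<exists>B. finite B \<and> span B = UNIV"
begin

lemma ip_add_right: "ip x (v + w) = ip x v + ip x w"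
  by (metis ip_add_left ip_cnj complex_cnj_add)

lemma ip_scale_right: "ip x (c *s v) = cnj c * ip x v"
  by (metis ip_scale_left ip_cnj complex_cnj_mult)

lemma ip_zero_left [simp]: "ip 0 x = 0"
  using ip_add_left[of 0 0 x] by simp

lemma ip_zero_right [simp]: "ip x 0 = 0"
  using ip_add_right[of x 0 0] by simp

lemma ip_diff_left: "ip (v - w) x = ip v x - ip w x"
  using ip_add_left[of "v - w" w x] by simp

lemma ip_sum_left: "ip (sum f S) x = (\<Sum>i\<in>S. ip (f i) x)"
  by (induction S rule: infinite_finite_induct) (auto simp: ip_add_left)

lemma ip_sum_right: "ip x (sum f S) = (\<Sum>i\<in>S. ip x (f i))"
  by (induction S rule: infinite_finite_induct) (auto simp: ip_add_right)

lemma ip_self_nonneg: "0 \<le> Re (ip v v)"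
  by (cases "v = 0") (auto dest: ip_pos)

lemma ip_self_eq_0: "ip v v = 0 \<Longrightarrow> v = 0"
  using ip_pos[of v] by auto

section \<open>Orthogonal projections\<close>

lemma span_finite_subset: "\<exists>B. finite B \<and> span B = span X"
proof -
  obtain D where D: "finite D" "span D = UNIV" using finite_dim by blast
  obtain B where B: "B \<subseteq> X" "independent B" "X \<subseteq> span B" using basis_exists[of X] by metis
  have "finite B" using independent_span_bound[OF D(1) B(2)] D(2) by auto
  moreover have "span B = span X" using B span_mono span_minimal[OF B(3)] by (simp add: subset_antisym)
  ultimately show ?thesis by blast
qed

text \<open>One Gram-Schmidt step per generator: \<open>b\<close> is replaced by its component
  \<open>e\<close> orthogonal to \<open>span B\<close>, and the projection of \<open>x\<close> onto
  the line of \<open>e\<close> is added to its projection onto \<open>span B\<close>.\<close>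

lemma finite_projection:
  assumes "finite B"
  shows "\<exists>u\<in>span B. \<forall>w\<in>span B. ip (x - u) w = 0"
  using assms
proof (induction B arbitrary: x)
  case empty
  then show ?case by (simp)
next
  case (insert b B)
  obtain v where v: "v \<in> span B" "\<And>w. w \<in> span B \<Longrightarrow> ip (b - v) w = 0"
    using insert.IH[of b] by blast
  obtain u where u: "u \<in> span B" "\<And>w. w \<in> span B \<Longrightarrow> ip (x - u) w = 0"
    using insert.IH[of x] by blast
  define e where "e = b - v"
  have sp: "w \<in> span (insert b B) \<longleftrightarrow> (\<exists>k. w - k *s e \<in> span B)" for w
  proof -
    have "w - k *s e \<in> span B \<longleftrightarrow> w - k *s b \<in> span B" for k
    proof -
      have "w - k *s e = (w - k *s b) + k *s v" by (simp add: e_def scale_right_diff_distrib)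
      then show ?thesis using v(1) span_scale span_add_eq2 by metis
    qed
    then show ?thesis by (simp add: span_breakdown_eq)
  qed
  \<comment> \<open>If \<open>e = 0\<close>, then \<open>b\<close> already lies in
    \<open>span B\<close> and the added term vanishes, whatever value the quotient has.\<close>
  define u' where "u' = u + (ip x e / ip e e) *s e"
  have "u' \<in> span (insert b B)"
    unfolding sp u'_def using u(1) by (intro exI[of _ "ip x e / ip e e"]) simp
  moreover have "ip (x - u') w = 0" if w: "w \<in> span (insert b B)" for w
  proof -
    obtain k where k: "w - k *s e \<in> span B" using w sp by blast
    define y where "y = w - k *s e"
    have w': "w = y + k *s e" and y: "y \<in> span B" using k by (auto simp: y_def)
    have e1: "ip e y = 0" using v(2)[OF y] by (simp add: e_def)
    have e2: "ip u e = 0" using v(2)[OF u(1)] ip_cnj[of e u] by (simp add: e_def)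
    have "ip (x - u') y = 0"
      using u(2)[OF y] e1 by (simp add: u'_def ip_diff_left ip_add_left ip_scale_left)
    moreover have "ip (x - u') e = 0"
      using e2 ip_self_eq_0[of e] by (cases "e = 0") (auto simp: u'_def ip_diff_left ip_add_left ip_scale_left)
    ultimately show ?thesis by (simp add: w' ip_add_right ip_scale_right)
  qed
  ultimately show ?case by blast
qed

lemma projection: "\<exists>u\<in>span X. \<forall>w\<in>span X. ip (x - u) w = 0"
  using finite_projection span_finite_subset[of X] by metis

section \<open>Bounds for linear operators\<close>

lemma parallelogram: "Re (ip (v + w) (v + w)) \<le> 2 * Re (ip v v) + 2 * Re (ip w w)"
proof -
  have "ip (v + w) (v + w) + ip (v - w) (v - w) = 2 * ip v v + 2 * ip w w"
    using ip_add_left[of "v - w" w v] ip_add_right[of _ "v - w" w]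
    by (simp add: ip_add_left ip_add_right ip_diff_left algebra_simps)
  from arg_cong[OF this, of Re] show ?thesis using ip_self_nonneg[of "v - w"] by simp
qed

text \<open>Boundedness of the operator norm by the same orthogonal induction: for
  \<open>w = y + k *s e\<close> with \<open>y\<close> orthogonal to \<open>e\<close>, the square
  norm of \<open>w\<close> splits, and the parallelogram inequality bounds that of
  \<open>F w\<close> by twice the two contributions.\<close>

lemma finite_bounded:
  assumes "finite B" and add: "\<And>v w. F (v + w) = F v + F w" and sc: "\<And>c v. F (c *s v) = c *s F v"
  shows "\<exists>M\<ge>0. \<forall>w\<in>span B. Re (ip (F w) (F w)) \<le> M * Re (ip w w)"
  using assms(1)
proof (induction B)
  case empty
  have "F 0 = 0" using add[of 0 0] by simp
  then show ?case by (auto intro: exI[of _ 0])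
next
  case (insert b B)
  obtain M where M: "M \<ge> 0" "\<And>w. w \<in> span B \<Longrightarrow> Re (ip (F w) (F w)) \<le> M * Re (ip w w)"
    using insert.IH by blast
  obtain v where v: "v \<in> span B" "\<And>w. w \<in> span B \<Longrightarrow> ip (b - v) w = 0"
    using finite_projection[OF insert.hyps(1), of b] by blast
  define e where "e = b - v"
  \<comment> \<open>For \<open>e = 0\<close> the quotient is \<open>0\<close>, which is the right
    value since \<open>F 0 = 0\<close>.\<close>
  define N where "N = Re (ip (F e) (F e)) / Re (ip e e)"
  have F0: "F 0 = 0" using add[of 0 0] by simp
  have N: "Re (ip (F e) (F e)) = N * Re (ip e e)"
    using ip_pos[of e] F0 by (cases "e = 0") (auto simp: N_def)
  have N0: "N \<ge> 0" unfolding N_def by (intro divide_nonneg_nonneg ip_self_nonneg)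
  have "Re (ip (F w) (F w)) \<le> (2 * M + 2 * N) * Re (ip w w)" if w: "w \<in> span (insert b B)" for w
  proof -
    obtain k where "w - k *s b \<in> span B" using w span_breakdown_eq by blast
    then have "(w - k *s b) + k *s v \<in> span B" by (intro span_add span_scale v(1))
    then have k: "w - k *s e \<in> span B" by (simp add: e_def scale_right_diff_distrib algebra_simps)
    define y where "y = w - k *s e"
    have w': "w = y + k *s e" and y: "y \<in> span B" using k by (auto simp: y_def)
    have e1: "ip e y = 0" using v(2)[OF y] by (simp add: e_def)
    have e2: "ip y e = 0" using e1 ip_cnj[of e y] by simp
    have sq: "Re (ip (k *s x) (k *s x)) = (cmod k)\<^sup>2 * Re (ip x x)" for x
    proof -
      have "ip (k *s x) (k *s x) = (k * cnj k) * ip x x" by (simp add: ip_scale_left ip_scale_right)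
      also have "k * cnj k = of_real ((cmod k)\<^sup>2)" by (rule complex_norm_square[symmetric])
      finally show ?thesis by simp
    qed
    have ww: "Re (ip w w) = Re (ip y y) + (cmod k)\<^sup>2 * Re (ip e e)"
      using e1 e2 sq[of e] by (simp add: w' ip_add_left ip_add_right ip_scale_left[of k e y] ip_scale_right[of y k e])
    have "Re (ip (F w) (F w)) \<le> 2 * Re (ip (F y) (F y)) + 2 * ((cmod k)\<^sup>2 * Re (ip (F e) (F e)))"
      using parallelogram[of "F y" "k *s F e"] by (simp add: w' add sc sq)
    also have "\<dots> \<le> 2 * (M * Re (ip y y)) + 2 * ((cmod k)\<^sup>2 * (N * Re (ip e e)))"
      using M(2)[OF y] N by simp
    also have "\<dots> \<le> (2 * M + 2 * N) * Re (ip w w)"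
    proof -
      have "0 \<le> N * Re (ip y y)" "0 \<le> M * ((cmod k)\<^sup>2 * Re (ip e e))"
        using M(1) N0 ip_self_nonneg by simp_all
      then show ?thesis unfolding ww by (simp add: algebra_simps)
    qed
    finally show ?thesis .
  qed
  then show ?case using M(1) N0 by (intro exI[of _ "2 * M + 2 * N"]) auto
qed

text \<open>Expanding the square norms of \<open>w + F w\<close> and \<open>w - F w\<close>, both
  nonnegative, bounds twice the absolute value of \<open>Re (ip w (F w))\<close> by the sum of the
  square norms of \<open>w\<close> and \<open>F w\<close>; the latter is at most \<open>M\<close>
  times the former.\<close>

lemma numerical_range_bounded:
  assumes add: "\<And>v w. F (v + w) = F v + F w" and sc: "\<And>c v. F (c *s v) = c *s F v"
  shows "\<exists>M\<ge>0. \<forall>w. \<bar>Re (ip w (F w))\<bar> \<le> M * Re (ip w w)"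
proof -
  obtain D where D: "finite D" "span D = UNIV" using finite_dim by blast
  obtain M where M: "M \<ge> 0" "\<And>w. Re (ip (F w) (F w)) \<le> M * Re (ip w w)"
    using finite_bounded[of D F, OF D(1) add sc] D(2) by auto
  have "\<bar>Re (ip w (F w))\<bar> \<le> (1 + M) * Re (ip w w)" for w
  proof -
    have sym: "Re (ip (F w) w) = Re (ip w (F w))" using arg_cong[OF ip_cnj[of "F w" w], of Re] by simp
    have "0 \<le> Re (ip (w + F w) (w + F w))" "0 \<le> Re (ip (w - F w) (w - F w))"
      by (rule ip_self_nonneg)+
    moreover have "Re (ip (w - F w) (w - F w)) = Re (ip w w) - 2 * Re (ip w (F w)) + Re (ip (F w) (F w))"
      using ip_add_right[of w "w - F w" "F w"] ip_add_right[of "F w" "w - F w" "F w"] sym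
      by (simp add: ip_diff_left algebra_simps)
    ultimately have "2 * \<bar>Re (ip w (F w))\<bar> \<le> Re (ip w w) + Re (ip (F w) (F w))"
      using sym by (simp add: ip_add_left ip_add_right abs_if)
    then show ?thesis using M(2)[of w] ip_self_nonneg[of w] mult_nonneg_nonneg[OF M(1) ip_self_nonneg[of w]]
      by (simp add: algebra_simps)
  qed
  then show ?thesis using M(1) by (intro exI[of _ "1 + M"]) auto
qed

section \<open>Eigenvectors and self-adjoint operators\<close>

lemma exists_eigenvector:
  assumes add: "\<And>v w. T (v + w) = T v + T w" and sc: "\<And>c v. T (c *s v) = c *s T v"
    and S: "subspace S" "\<And>v. v \<in> S \<Longrightarrow> T v \<in> S" and x: "x \<in> S" "x \<noteq> 0"
  shows "\<exists>w\<in>S. w \<noteq> 0 \<and> (\<exists>c. T w = c *s w)"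
proof -
  \<comment> \<open>Horner's scheme: \<open>ev p\<close> is the vector p(T) x.\<close>
  define ev where "ev p = fold_coeffs (\<lambda>a v. a *s x + T v) p 0" for p
  have T0: "T 0 = 0" using add[of 0 0] by simp
  have ev0 [simp]: "ev 0 = 0" by (simp add: ev_def)
  have evC: "ev (pCons a p) = a *s x + T (ev p)" for a p
    using T0 by (cases "p = 0 \<and> a = 0") (auto simp: ev_def)
  have evS: "ev p \<in> S" for p
    by (induction p) (auto simp: evC intro!: subspace_add[OF S(1)] subspace_scale[OF S(1)] S(2) x(1) subspace_0[OF S(1)])
  have ev_smult: "ev (smult c p) = c *s ev p" for c p
    by (induction p) (auto simp: evC sc scale_right_distrib)
  have ev_add: "ev (p + q) = ev p + ev q" for p q
    by (induction p q rule: poly_induct2) (auto simp: evC add algebra_simps)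
  have ev_sum: "ev (sum f I) = (\<Sum>i\<in>I. ev (f i))" for f and I :: "nat set"
    by (induction I rule: infinite_finite_induct) (auto simp: ev_add)
  \<comment> \<open>Otherwise the iterates of \<open>T\<close> on \<open>x\<close> with exponents
    from \<open>0\<close> to \<open>card D\<close> would be \<open>card D + 1\<close> independent
    vectors in a space spanned by \<open>card D\<close> vectors.\<close>
  have "\<exists>p. p \<noteq> 0 \<and> ev p = 0"
  proof (rule ccontr)
    assume "\<not> ?thesis"
    then have inj: "p = 0" if "ev p = 0" for p using that by blast
    define f where "f i = ev (monom 1 i)" for i
    have injf: "inj f"
    proof (rule injI)
      fix i j assume "f i = f j"
      then have "ev (monom 1 i + smult (-1) (monom 1 j)) = 0"
        by (simp add: ev_add ev_smult f_def del: smult_monom smult_minus_left)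
      then have "monom 1 i + smult (-1) (monom 1 j) = (0::complex poly)" using inj by blast
      then have "monom 1 i = (monom 1 j :: complex poly)" by simp
      then show "i = j" using degree_monom_eq[of "1::complex"] by (metis one_neq_zero)
    qed
    obtain D where D: "finite D" "span D = UNIV" using finite_dim by blast
    have "independent (f ` {..card D})"
    proof (rule independent_if_scalars_zero)
      fix g y assume g: "(\<Sum>y\<in>f ` {..card D}. g y *s y) = 0" and y: "y \<in> f ` {..card D}"
      have "(\<Sum>i\<le>card D. g (f i) *s f i) = 0"
        using g by (subst (asm) sum.reindex) (auto intro: inj_on_subset[OF injf])
      then have "ev (\<Sum>i\<le>card D. smult (g (f i)) (monom 1 i)) = 0"
        by (simp add: ev_sum ev_smult f_def del: smult_monom)
      then have "(\<Sum>i\<le>card D. smult (g (f i)) (monom 1 i)) = (0 :: complex poly)" using inj by blast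
      then have z: "(\<Sum>i\<le>card D. monom (g (f i)) i) = (0 :: complex poly)" by (simp add: smult_monom)
      obtain j where j: "y = f j" "j \<le> card D" using y by auto
      have "coeff (\<Sum>i\<le>card D. monom (g (f i)) i) j = g (f j)"
        using j(2) by (simp add: coeff_sum)
      then show "g y = 0" using z j(1) by simp
    qed simp
    from independent_span_bound[OF D(1) this] D(2)
    have "card (f ` {..card D}) \<le> card D" by auto
    moreover have "card (f ` {..card D}) = Suc (card D)"
      using card_image[OF inj_on_subset[OF injf], of "{..card D}"] by simp
    ultimately show False by simp
  qed
  then obtain p where "p \<noteq> 0" "ev p = 0" by blast
  \<comment> \<open>Split off a root: p = (X - r) q. Either \<open>ev q = 0\<close> and the degree
    drops, or \<open>ev q\<close> is an eigenvector for \<open>r\<close>. A nonzero constant cannot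
    annihilate \<open>x\<close>, so the descent stops before degree \<open>0\<close>.\<close>
  then show ?thesis
  proof (induction "degree p" arbitrary: p)
    case 0
    then obtain a where "p = [:a:]" by (metis degree_eq_zeroE)
    then show ?case using 0 x T0 by (auto simp: evC)
  next
    case (Suc n)
    have "\<not> constant (poly p)" using Suc.hyps(2) constant_degree[of p] by simp
    then obtain r where "poly p r = 0" using fundamental_theorem_of_algebra by blast
    then obtain q where q: "p = [:-r, 1:] * q" by (metis poly_eq_0_iff_dvd dvdE)
    have q0: "q \<noteq> 0" and dq: "degree q = n"
    proof -
      show "q \<noteq> 0" using Suc.prems(1) q by auto
      then have "degree p = 1 + degree q" unfolding q by (subst degree_mult_eq) auto
      then show "degree q = n" using Suc.hyps(2) by simp
    qed
    have "ev p = - r *s ev q + T (ev q)"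
      by (simp add: q ev_add ev_smult evC  del: smult_minus_left)
    then have T: "T (ev q) = r *s ev q" using Suc.prems(2) by simp
    show ?case
    proof (cases "ev q = 0")
      case True
      then show ?thesis using Suc.hyps(1)[of q] dq q0 by simp
    next
      case False
      then show ?thesis using T evS by blast
    qed
  qed
qed

text \<open>The vectors of \<open>S\<close> orthogonal to all real eigenvectors form a
  \<open>T\<close>-stable subspace by self-adjointness. If it were nonzero it would contain an
  eigenvector, whose eigenvalue is real, so this vector would be orthogonal to itself.\<close>

lemma spectral_decomposition:
  assumes add: "\<And>v w. T (v + w) = T v + T w" and sc: "\<And>c v. T (c *s v) = c *s T v"
    and S: "subspace S" "\<And>v. v \<in> S \<Longrightarrow> T v \<in> S"
    and sa: "\<And>v w. v \<in> S \<Longrightarrow> w \<in> S \<Longrightarrow> ip (T v) w = ip v (T w)"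
  shows "S \<subseteq> span {w \<in> S. \<exists>l. T w = of_real l *s w}" (is "_ \<subseteq> span ?X")
proof
  fix v assume v: "v \<in> S"
  have T0: "T 0 = 0" using add[of 0 0] by simp
  have ES: "span ?X \<subseteq> S" by (rule span_minimal) (use S in auto)
  have ET: "T e \<in> span ?X" if "e \<in> span ?X" for e
    using that
  proof (induction rule: span_induct_alt)
    case base then show ?case by (simp add: T0 span_zero)
  next
    case (step c x y)
    then have "T x \<in> span ?X" using span_scale span_base by fastforce
    then show ?case using step by (simp add: add sc span_add span_scale)
  qed
  obtain u where u: "u \<in> span ?X" "\<And>w. w \<in> span ?X \<Longrightarrow> ip (v - u) w = 0"
    using projection[of ?X v] by blast
  show "v \<in> span ?X"
  proof (rule ccontr)
    assume "v \<notin> span ?X"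
    then have ne: "v - u \<noteq> 0" using u(1) by auto
    \<comment> \<open>The orthogonal complement, inside \<open>S\<close>, of the span of the
      eigenvectors.\<close>
    define S' where "S' = {w \<in> S. \<forall>e\<in>span ?X. ip w e = 0}"
    have sub: "subspace S'"
      unfolding S'_def using S(1)
      by (auto simp: subspace_def ip_add_left ip_scale_left)
    have mem: "v - u \<in> S'" using v u ES subspace_diff[OF S(1)] by (auto simp: S'_def)
    have "T w \<in> S'" if "w \<in> S'" for w
      using that ET ES S(2) sa unfolding S'_def by (auto simp: subset_iff)
    from exists_eigenvector[OF add sc sub this mem ne]
    obtain w c where w: "w \<in> S'" "w \<noteq> 0" "T w = c *s w" by blast
    have "c * ip w w = cnj c * ip w w"
      using sa[of w w] w by (simp add: S'_def ip_scale_left ip_scale_right)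
    then have "c = cnj c" using w(2) ip_self_eq_0 by auto
    then have "c = of_real (Re c)" by (simp add: complex_eq_iff)
    then have "w \<in> ?X" using w unfolding S'_def by auto
    then have "w \<in> span ?X" by (rule span_base)
    then have "ip w w = 0" using w(1) by (auto simp: S'_def)
    then show False using w(2) ip_self_eq_0 by blast
  qed
qed

text \<open>Collecting terms by eigenvalue writes \<open>w\<close> as a sum of pairwise orthogonal
  \<open>f l\<close>, so \<open>ip w (T w)\<close> is the sum of \<open>l\<close> times the square
  norms of the \<open>f l\<close>, with all \<open>l > 0\<close>.\<close>

lemma span_positive_eigenvectors_positive:
  assumes add: "\<And>v w. T (v + w) = T v + T w" and sc: "\<And>c v. T (c *s v) = c *s T v"
    and S: "subspace S"
    and sa: "\<And>v w. v \<in> S \<Longrightarrow> w \<in> S \<Longrightarrow> ip (T v) w = ip v (T w)"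
    and w: "w \<in> span {w \<in> S. \<exists>l>0. T w = of_real l *s w}" and "w \<noteq> 0"
  shows "0 < Re (ip w (T w))"
proof -
  define E where "E l = {w \<in> S. T w = complex_of_real l *s w}" for l
  have T0: "T 0 = 0" using add[of 0 0] by simp
  have Tsum: "T (sum f I) = (\<Sum>i\<in>I. T (f i))" for f and I :: "real set"
    by (induction I rule: infinite_finite_induct) (auto simp: T0 add)
  have subE: "subspace (E l)" for l
    using S unfolding E_def subspace_def
    by (auto simp: T0 add sc scale_right_distrib mult.commute)
  have orth: "ip x y = 0" if "x \<in> E l" "y \<in> E m" "l \<noteq> m" for x y l m
  proof -
    have "of_real l * ip x y = of_real m * ip x y"
      using sa[of x y] that by (simp add: E_def ip_scale_left ip_scale_right)
    then show ?thesis using that(3) by simp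
  qed
  have "\<exists>L f. finite L \<and> L \<subseteq> {0<..} \<and> (\<forall>l. f l \<in> E l) \<and> w = sum f L"
    using w
  proof (induction rule: span_induct_alt)
    case base
    show ?case by (intro exI[of _ "{}"] exI[of _ "\<lambda>_. 0"]) (auto simp: subspace_0[OF subE])
  next
    case (step c x y)
    then obtain L f where f: "finite L" "L \<subseteq> {0<..}" "\<And>l. f l \<in> E l" "y = sum f L" by blast
    obtain l where l: "l > 0" "x \<in> E l" using step by (auto simp: E_def)
    \<comment> \<open>Two separate summands, because the eigenvalue \<open>l\<close> of the new
      vector may or may not already occur in \<open>L\<close>.\<close>
    define f' where "f' k = (if k \<in> L then f k else 0) + (if k = l then c *s x else 0)" for k
    have "f' k \<in> E k" for k
      using f(3)[of k] l(2) subspace_0[OF subE] subspace_add[OF subE] subspace_scale[OF subE]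
      by (auto simp: f'_def)
    moreover have "sum f' (insert l L) = c *s x + y"
    proof -
      have "sum f' (insert l L) = (\<Sum>k\<in>insert l L. if k \<in> L then f k else 0) + (\<Sum>k\<in>insert l L. if k = l then c *s x else 0)"
        unfolding f'_def by (rule sum.distrib)
      also have "(\<Sum>k\<in>insert l L. if k \<in> L then f k else 0) = y"
        unfolding f(4) by (rule sum.mono_neutral_cong_right) (use f(1) in auto)
      finally show ?thesis using f(1) by simp
    qed
    ultimately show ?case using f(1,2) l(1)
      by (intro exI[of _ "insert l L"] exI[of _ f']) auto
  qed
  then obtain L f where f: "finite L" "L \<subseteq> {0<..}" "\<And>l. f l \<in> E l" "w = sum f L" by blast
  have Tf: "T (f l) = of_real l *s f l" for l using f(3)[of l] by (simp add: E_def)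
  have "ip w (T w) = (\<Sum>l\<in>L. \<Sum>m\<in>L. of_real m * ip (f l) (f m))"
    by (simp only: f(4) Tsum Tf ip_sum_left ip_sum_right ip_scale_right complex_cnj_complex_of_real sum_distrib_left)
       (rule sum.swap)
  also have "\<dots> = (\<Sum>l\<in>L. of_real l * ip (f l) (f l))"
  proof (rule sum.cong[OF refl])
    fix l assume l: "l \<in> L"
    have "(\<Sum>m\<in>L. of_real m * ip (f l) (f m)) = (\<Sum>m\<in>L. if m = l then of_real l * ip (f l) (f l) else 0)"
      using orth[OF f(3) f(3)] by (intro sum.cong) auto
    then show "(\<Sum>m\<in>L. of_real m * ip (f l) (f m)) = of_real l * ip (f l) (f l)"
      using l f(1) by simp
  qed
  finally have eq: "Re (ip w (T w)) = (\<Sum>l\<in>L. l * Re (ip (f l) (f l)))" by simp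
  obtain l where l: "l \<in> L" "f l \<noteq> 0" using \<open>w \<noteq> 0\<close> f(4) by (metis sum.neutral)
  show ?thesis unfolding eq
    by (rule sum_pos2[OF f(1) l(1)]) (use f(2) l ip_pos[of "f l"] ip_self_nonneg in \<open>auto simp: subset_iff less_imp_le\<close>)
qed

end

section \<open>Complexification\<close>

lemma of_rat_cnj [simp]: "cnj (of_rat q) = of_rat q"
  by (cases q) (simp add: of_rat_rat)

lemma tensor_add_left: "(x + y) \<otimes>\<^sub>C c = x \<otimes>\<^sub>C c + y \<otimes>\<^sub>C c"
  by transfer (auto simp: tensor_eq_def Q_functional_def algebra_simps)

lemma tensor_add_right: "x \<otimes>\<^sub>C (c + d) = x \<otimes>\<^sub>C c + x \<otimes>\<^sub>C d"
  by transfer (auto simp: tensor_eq_def algebra_simps)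

lemma tensor_scaleQ: "(q *\<^sub>Q x) \<otimes>\<^sub>C c = x \<otimes>\<^sub>C (of_rat q * c)"
  by transfer (auto simp: tensor_eq_def Q_functional_def algebra_simps)

lemma scaleC_tensor: "c *\<^sub>C (x \<otimes>\<^sub>C d) = x \<otimes>\<^sub>C (c * d)"
  by transfer (auto simp: tensor_eq_def)

lemma tensor_zero [simp]: "0 \<otimes>\<^sub>C c = 0" "x \<otimes>\<^sub>C 0 = 0"
  using tensor_add_left[of 0 0 c] tensor_add_right[of x 0 0] by simp_all

text \<open>Every element is a finite sum of elementary tensors; the empty sum is covered by the
  tensor of \<open>0\<close> and \<open>0\<close>, so no separate case for zero arises.\<close>

lemma complexification_induct [case_names tensor add]:
  fixes v :: "'h::rat_vector complexification"
  assumes T: "\<And>x c. P (x \<otimes>\<^sub>C c)" and A: "\<And>v w. P v \<Longrightarrow> P w \<Longrightarrow> P (v + w)"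
  shows "P v"
proof -
  have "P (abs_complexification xs)" for xs :: "('h \<times> complex) list"
  proof (induction xs)
    case Nil
    have "abs_complexification [] = (0 \<otimes>\<^sub>C 0 :: 'h complexification)"
      by (simp add: zero_complexification.abs_eq[symmetric])
    then show ?case using T by metis
  next
    case (Cons a xs)
    obtain x c where a: "a = (x, c)" by (cases a)
    have "abs_complexification (a # xs) = x \<otimes>\<^sub>C c + abs_complexification xs"
      by (simp add: a tensor.abs_eq plus_complexification.abs_eq)
    then show ?case using Cons T A by metis
  qed
  then show ?thesis by (metis complexification.abs_induct)
qed

lemma conjugate_tensor [simp]: "conjugate (x \<otimes>\<^sub>C c) = x \<otimes>\<^sub>C cnj c"
  by transfer (auto simp: tensor_eq_def)

lemma conjugate_add [simp]: "conjugate (v + w) = conjugate v + conjugate w"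
  by transfer (auto simp: tensor_eq_def)

lemma conjugate_conjugate [simp]: "conjugate (conjugate v) = v"
  by (induction v rule: complexification_induct) auto

lemma conjugate_zero [simp]: "conjugate 0 = 0"
  using conjugate_add[of 0 0] by simp

lemma conjugate_minus [simp]: "conjugate (- v) = - conjugate v"
  using conjugate_add[of v "- v"] by (simp add: eq_neg_iff_add_eq_0 add.commute)

lemma conjugate_diff [simp]: "conjugate (v - w) = conjugate v - conjugate w"
  by (simp only: diff_conv_add_uminus conjugate_add conjugate_minus)

lemma conjugate_scaleC [simp]: "conjugate (c *\<^sub>C v) = cnj c *\<^sub>C conjugate v"
  by (induction v rule: complexification_induct)
     (auto simp: scaleC_tensor Cvec.scale_right_distrib)

lemma conjugate_mult [simp]: "conjugate (v * w) = conjugate v * conjugate w"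
proof (induction v rule: complexification_induct)
  case (tensor x c)
  show ?case
    by (induction w rule: complexification_induct) (auto simp: tensor_times_tensor distrib_left)
qed (auto simp: distrib_right)

lemma conjugate_span:
  fixes X :: "'h::rat_vector complexification set"
  shows "conjugate ` Cvec.span X = Cvec.span (conjugate ` X)"
proof -
  have sub: "conjugate w \<in> Cvec.span (conjugate ` X)" if "w \<in> Cvec.span X" for w and X :: "'h complexification set"
    using that
    by (induction rule: Cvec.span_induct_alt)
       (auto simp: Cvec.span_zero intro!: Cvec.span_add Cvec.span_scale intro: Cvec.span_base)
  have "w \<in> conjugate ` Cvec.span X" if "w \<in> Cvec.span (conjugate ` X)" for w
    using sub[OF that] by (auto simp: image_image intro!: image_eqI[of _ _ "conjugate w"])
  then show ?thesis using sub by blast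
qed

lemma scaleC_mult_left: "(c *\<^sub>C v) * w = c *\<^sub>C (v * w)"
proof (induction v rule: complexification_induct)
  case (tensor x c)
  show ?case
    by (induction w rule: complexification_induct)
       (auto simp: tensor_times_tensor scaleC_tensor distrib_left Cvec.scale_right_distrib mult.assoc)
qed (auto simp: distrib_right Cvec.scale_right_distrib)

lemma scaleC_mult_right: "v * (c *\<^sub>C w) = c *\<^sub>C (v * w)"
proof (induction v rule: complexification_induct)
  case (tensor x d)
  show ?case
    by (induction w rule: complexification_induct)
       (auto simp: tensor_times_tensor scaleC_tensor distrib_left Cvec.scale_right_distrib mult_ac)
qed (auto simp: distrib_right Cvec.scale_right_distrib)

section \<open>Complex extension of bilinear forms\<close>

lemma extend_form_tensor:
  "Q_bilinear_form \<beta> \<Longrightarrow> extend_form \<beta> (x \<otimes>\<^sub>C c) (y \<otimes>\<^sub>C d) = c * d * of_rat (\<beta> x y)"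
  by transfer simp

lemma sum_list_prod_add:
  fixes f g :: "'a \<Rightarrow> 'b \<Rightarrow> 'c::comm_monoid_add"
  shows "(\<Sum>(x, c)\<leftarrow>xs. f x c + g x c) = (\<Sum>(x, c)\<leftarrow>xs. f x c) + (\<Sum>(x, c)\<leftarrow>xs. g x c)"
  by (induction xs) (auto simp: ac_simps)

lemma extend_form_add_left: "extend_form \<beta> (v + w) x = extend_form \<beta> v x + extend_form \<beta> w x"
  by transfer auto

lemma extend_form_add_right: "extend_form \<beta> x (v + w) = extend_form \<beta> x v + extend_form \<beta> x w"
  by transfer (auto simp: sum_list_prod_add)

lemma extend_form_scale_left: "extend_form \<beta> (c *\<^sub>C v) w = c * extend_form \<beta> v w"
proof (cases "Q_bilinear_form \<beta>")
  case True
  show ?thesis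
  proof (induction v rule: complexification_induct)
    case (tensor x d)
    show ?case
      by (induction w rule: complexification_induct)
         (auto simp: extend_form_tensor[OF True] scaleC_tensor extend_form_add_right algebra_simps)
  qed (auto simp: extend_form_add_left Cvec.scale_right_distrib algebra_simps)
qed (transfer, simp)

lemma extend_form_scale_right: "extend_form \<beta> v (c *\<^sub>C w) = c * extend_form \<beta> v w"
proof (cases "Q_bilinear_form \<beta>")
  case True
  show ?thesis
  proof (induction v rule: complexification_induct)
    case (tensor x d)
    show ?case
      by (induction w rule: complexification_induct)
         (auto simp: extend_form_tensor[OF True] scaleC_tensor extend_form_add_right
            Cvec.scale_right_distrib algebra_simps)
  qed (auto simp: extend_form_add_left algebra_simps)
qed (transfer, simp)

lemma extend_form_cnj:
  assumes "Q_bilinear_form \<beta>"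
  shows "cnj (extend_form \<beta> v w) = extend_form \<beta> (conjugate v) (conjugate w)"
proof (induction v rule: complexification_induct)
  case (tensor x d)
  show ?case
    by (induction w rule: complexification_induct)
       (auto simp: extend_form_tensor[OF assms] extend_form_add_right)
qed (auto simp: extend_form_add_left)

text \<open>With \<open>e = 1\<close> this carries symmetry over to the complex extension, with
  \<open>e = - 1\<close> skew-symmetry.\<close>

lemma extend_form_swap:
  assumes "Q_bilinear_form \<beta>" "Q_bilinear_form \<gamma>" "\<And>x y. \<beta> x y = e * \<gamma> y x"
  shows "extend_form \<beta> v w = of_rat e * extend_form \<gamma> w v"
proof -
  have eq: "complex_of_rat (\<beta> x y) = of_rat e * of_rat (\<gamma> y x)" for x y
    by (simp only: assms(3) of_rat_mult)
  show ?thesis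
  proof (induction v rule: complexification_induct)
    case (tensor x d)
    show ?case
      by (induction w rule: complexification_induct)
         (auto simp: extend_form_tensor[OF assms(1)] extend_form_tensor[OF assms(2)] eq
            extend_form_add_right extend_form_add_left algebra_simps)
  qed (auto simp: extend_form_add_left extend_form_add_right algebra_simps)
qed

lemma hermitian_form_simps:
  "hermitian_form \<beta> (v + w) x = hermitian_form \<beta> v x + hermitian_form \<beta> w x"
  "hermitian_form \<beta> x (v + w) = hermitian_form \<beta> x v + hermitian_form \<beta> x w"
  "hermitian_form \<beta> (c *\<^sub>C v) x = c * hermitian_form \<beta> v x"
  "hermitian_form \<beta> v (c *\<^sub>C x) = cnj c * hermitian_form \<beta> v x"
  by (simp_all add: hermitian_form_def extend_form_add_left extend_form_add_right
      extend_form_scale_left extend_form_scale_right)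

lemma hermitian_form_zero [simp]: "hermitian_form \<beta> 0 x = 0" "hermitian_form \<beta> x 0 = 0"
  using hermitian_form_simps(1)[of \<beta> 0 0 x] hermitian_form_simps(2)[of \<beta> x 0 0] by simp_all

lemma hermitian_form_minus [simp]: "hermitian_form \<beta> (- v) x = - hermitian_form \<beta> v x"
  "hermitian_form \<beta> v (- x) = - hermitian_form \<beta> v x"
  using hermitian_form_simps(1)[of \<beta> v "- v" x] hermitian_form_simps(2)[of \<beta> v x "- x"]
  by (simp_all add: eq_neg_iff_add_eq_0 add.commute)

section \<open>Coordinates with respect to a rational basis\<close>

locale rat_basis =
  fixes B :: "'h::rat_vector set"
  assumes finite_B: "finite B" and independent_B: "Qvec.independent B" and span_B: "Qvec.span B = UNIV"
begin

lift_definition coord :: "'h \<Rightarrow> 'h complexification \<Rightarrow> complex"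
  is "\<lambda>b. eval_tensor (\<lambda>x. of_rat (Qvec.representation B x b))"
proof -
  fix b :: 'h and xs ys :: "('h \<times> complex) list"
  have "Q_functional (\<lambda>x. of_rat (Qvec.representation B x b) :: complex)"
    using independent_B span_B
    by (simp add: Q_functional_def Qvec.representation_add Qvec.representation_scale of_rat_add of_rat_mult)
  then show "tensor_eq xs ys \<Longrightarrow> eval_tensor (\<lambda>x. of_rat (Qvec.representation B x b)) xs =
      eval_tensor (\<lambda>x. of_rat (Qvec.representation B x b)) ys"
    by (simp add: tensor_eq_def)
qed

lemma coord_add: "coord b (v + w) = coord b v + coord b w"
  by transfer simp

lemma coord_tensor: "coord b (x \<otimes>\<^sub>C c) = c * of_rat (Qvec.representation B x b)"
  by transfer simp

lemma coord_conjugate: "coord b (conjugate v) = cnj (coord b v)"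
  by (induction v rule: complexification_induct) (auto simp: coord_add coord_tensor)

lemma tensor_sum_left: "sum f I \<otimes>\<^sub>C c = (\<Sum>i\<in>I. f i \<otimes>\<^sub>C c)"
  by (induction I rule: infinite_finite_induct) (auto simp: tensor_add_left)

lemma basis_expansion: "(\<Sum>b\<in>B. Qvec.representation B x b *\<^sub>Q b) = x"
  using Qvec.sum_representation_eq[OF independent_B, of x B] finite_B span_B by simp

lemma coord_expansion: "v = (\<Sum>b\<in>B. b \<otimes>\<^sub>C coord b v)"
proof (induction v rule: complexification_induct)
  case (tensor x c)
  have "(\<Sum>b\<in>B. b \<otimes>\<^sub>C coord b (x \<otimes>\<^sub>C c)) = (\<Sum>b\<in>B. Qvec.representation B x b *\<^sub>Q b) \<otimes>\<^sub>C c"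
    by (simp add: coord_tensor tensor_sum_left tensor_scaleQ mult.commute)
  then show ?case by (simp add: basis_expansion)
next
  case (add v w)
  then show ?case by (simp add: coord_add tensor_add_right sum.distrib)
qed

lemma finite_dim_complexification: "\<exists>D :: 'h complexification set. finite D \<and> Cvec.span D = UNIV"
proof (intro exI conjI)
  show "finite ((\<lambda>b. b \<otimes>\<^sub>C 1) ` B)" using finite_B by simp
  have "v \<in> Cvec.span ((\<lambda>b. b \<otimes>\<^sub>C 1) ` B)" for v :: "'h complexification"
  proof -
    have "v = (\<Sum>b\<in>B. coord b v *\<^sub>C (b \<otimes>\<^sub>C 1))"
      using coord_expansion[of v] by (simp add: scaleC_tensor)
    also have "\<dots> \<in> Cvec.span ((\<lambda>b. b \<otimes>\<^sub>C 1) ` B)"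
      by (intro Cvec.span_sum Cvec.span_scale Cvec.span_base) auto
    finally show ?thesis .
  qed
  then show "Cvec.span ((\<lambda>b. b \<otimes>\<^sub>C 1) ` B) = UNIV" by auto
qed

text \<open>For rational-linear \<open>f\<close> this is the complex-linear extension of
  \<open>f\<close>; the formula in coordinates makes it a total function without a well-definedness
  proof.\<close>

definition extend_map :: "('h \<Rightarrow> 'h) \<Rightarrow> 'h complexification \<Rightarrow> 'h complexification" where
  "extend_map f v = (\<Sum>b\<in>B. f b \<otimes>\<^sub>C coord b v)"

lemma extend_map_add: "extend_map f (v + w) = extend_map f v + extend_map f w"
  by (simp add: extend_map_def coord_add tensor_add_right sum.distrib)

lemma extend_map_tensor:
  assumes "Vector_Spaces.linear scaleQ scaleQ f"
  shows "extend_map f (x \<otimes>\<^sub>C c) = f x \<otimes>\<^sub>C c"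
proof -
  interpret Vector_Spaces.linear scaleQ scaleQ f by fact
  have "extend_map f (x \<otimes>\<^sub>C c) = f (\<Sum>b\<in>B. Qvec.representation B x b *\<^sub>Q b) \<otimes>\<^sub>C c"
    by (simp add: extend_map_def coord_tensor sum scale tensor_sum_left tensor_scaleQ mult.commute)
  then show ?thesis by (simp add: basis_expansion)
qed

lemma conjugate_real_part:
  assumes "conjugate v = v"
  shows "v = (\<Sum>b\<in>B. b \<otimes>\<^sub>C of_real (Re (coord b v)))"
proof -
  have "of_real (Re (coord b v)) = coord b v" for b
    using coord_conjugate[of b v] assms by (simp add: complex_eq_iff)
  then show ?thesis using coord_expansion[of v] by simp
qed

lemma extend_map_sum: "extend_map f (sum g I) = (\<Sum>i\<in>I. extend_map f (g i))"
  by (induction I rule: infinite_finite_induct)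
     (simp_all add: extend_map_add, simp_all add: extend_map_def coord_tensor[of _ 0 0, simplified])

text \<open>For a rational-linear \<open>l\<close> this is the identity on \<open>H\<close> tensored
  with \<open>l\<close>. It turns complexified vectors into vectors of \<open>H\<close> and so
  transports identities from the complexification to the rational algebra.\<close>

definition contract :: "(complex \<Rightarrow> rat) \<Rightarrow> 'h complexification \<Rightarrow> 'h" where
  "contract l v = (\<Sum>b\<in>B. l (coord b v) *\<^sub>Q b)"

lemma contract_add:
  assumes "\<And>c d. l (c + d) = l c + l d"
  shows "contract l (v + w) = contract l v + contract l w"
  by (simp add: contract_def coord_add assms scaleQ_add_left sum.distrib)

lemma contract_tensor:
  assumes "\<And>q c. l (of_rat q * c) = q * l c"
  shows "contract l (x \<otimes>\<^sub>C c) = l c *\<^sub>Q x"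
proof -
  have "contract l (x \<otimes>\<^sub>C c) = l c *\<^sub>Q (\<Sum>b\<in>B. Qvec.representation B x b *\<^sub>Q b)"
    by (simp add: contract_def coord_tensor mult.commute[of c] assms Qvec.scale_sum_right scaleQ_scaleQ mult.commute[of "l c"])
  then show ?thesis by (simp add: basis_expansion)
qed

text \<open>A nonzero complex coordinate is independent over the rationals, hence some rational
  functional \<open>l\<close> takes the value \<open>1\<close> on it; independence of
  \<open>B\<close> then keeps the contraction nonzero.\<close>

lemma contract_nonzero:
  assumes "v \<noteq> 0"
  obtains l where "\<And>c d. l (c + d) = l c + l d" "\<And>q c. l (of_rat q * c) = q * l c" "contract l v \<noteq> 0"
proof -
  obtain b where b: "b \<in> B" "coord b v \<noteq> 0"
    using assms coord_expansion[of v] by (metis (no_types, lifting) sum.neutral tensor_zero(2))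
  interpret P: vector_space_pair "\<lambda>q z. of_rat q * z :: complex" "(*) :: rat \<Rightarrow> rat \<Rightarrow> rat"
    by unfold_locales (simp_all add: algebra_simps of_rat_add of_rat_mult)
  have "P.vs1.independent {coord b v}" using b by (simp add: P.vs1.independent_insert)
  from P.linear_independent_extend[OF this, of "\<lambda>_. 1"]
  obtain l where l: "Vector_Spaces.linear (\<lambda>q z. of_rat q * z :: complex) (*) l" "l (coord b v) = 1" by auto
  have "contract l v \<noteq> 0"
  proof
    assume "contract l v = 0"
    then have "l (coord b v) = 0"
      using Qvec.independentD[OF independent_B finite_B subset_refl, of "\<lambda>b. l (coord b v)" b] b(1)
      by (simp add: contract_def)
    then show False using l(2) by simp
  qed
  with l(1) show ?thesis by (intro that[of l]) (auto simp: Vector_Spaces.linear_iff)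
qed

end

section \<open>The idempotent of the grading\<close>

locale hodge_algebra = rat_basis B
  for B :: "'h::rat_algebra_1 set" +
  fixes Hdg :: "int \<Rightarrow> int \<Rightarrow> 'h complexification set"
    and form :: "'h \<Rightarrow> 'h \<Rightarrow> rat"
    and t :: "'h \<Rightarrow> 'h"
  assumes hodge: "hodge_structure_2 Hdg"
    and polarization: "polarizes_2 Hdg form"
    and product: "product_has_bidegree_minus_one Hdg"
    and t_linear: "Vector_Spaces.linear scaleQ scaleQ t"
    and t_involutive: "t (t x) = x"
    and t_adjoint_left: "form (a * x) y = form x (t a * y)"
    and t_adjoint_right: "form (x * a) y = form x (y * t a)"
begin

abbreviation h where "h \<equiv> hermitian_form form"
abbreviation A1 where "A1 \<equiv> Hdg 2 0"
abbreviation A0 where "A0 \<equiv> Hdg 1 1"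
abbreviation Am where "Am \<equiv> Hdg 0 2"

lemma bilinear_form: "Q_bilinear_form form"
  using polarization by (simp add: polarizes_2_def)

lemma form_sym: "form x y = form y x"
  using polarization by (simp add: polarizes_2_def)

lemma subspace_Hdg: "Cvec.subspace (Hdg p q)"
  using hodge by (simp add: hodge_structure_2_def)

lemmas Hdg_zero [simp] = Cvec.subspace_0[OF subspace_Hdg]
lemmas Hdg_add = Cvec.subspace_add[OF subspace_Hdg]
lemmas Hdg_diff = Cvec.subspace_diff[OF subspace_Hdg]
lemmas Hdg_scale = Cvec.subspace_scale[OF subspace_Hdg]

lemma Hdg_mult: "v \<in> Hdg p q \<Longrightarrow> w \<in> Hdg r s \<Longrightarrow> v * w \<in> Hdg (p + r - 1) (q + s - 1)"
  using product by (simp add: product_has_bidegree_minus_one_def)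

lemma Hdg_trivial: "(p, q) \<notin> {(2, 0), (1, 1), (0, 2)} \<Longrightarrow> Hdg p q = {0}"
  using hodge by (simp add: hodge_structure_2_def)

lemma mult_11: "v \<in> A1 \<Longrightarrow> w \<in> A1 \<Longrightarrow> v * w = 0"
  using Hdg_mult[of v 2 0 w 2 0] Hdg_trivial[of 3 "-1"] by simp

lemma mult_mm: "v \<in> Am \<Longrightarrow> w \<in> Am \<Longrightarrow> v * w = 0"
  using Hdg_mult[of v 0 2 w 0 2] Hdg_trivial[of "-1" 3] by simp

lemma mult_components:
  "v \<in> A1 \<Longrightarrow> w \<in> A0 \<Longrightarrow> v * w \<in> A1"
  "v \<in> A1 \<Longrightarrow> w \<in> Am \<Longrightarrow> v * w \<in> A0"
  "v \<in> A0 \<Longrightarrow> w \<in> A1 \<Longrightarrow> v * w \<in> A1"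
  "v \<in> A0 \<Longrightarrow> w \<in> A0 \<Longrightarrow> v * w \<in> A0"
  "v \<in> A0 \<Longrightarrow> w \<in> Am \<Longrightarrow> v * w \<in> Am"
  "v \<in> Am \<Longrightarrow> w \<in> A1 \<Longrightarrow> v * w \<in> A0"
  "v \<in> Am \<Longrightarrow> w \<in> A0 \<Longrightarrow> v * w \<in> Am"
  using Hdg_mult[of v 2 0 w 1 1] Hdg_mult[of v 2 0 w 0 2] Hdg_mult[of v 1 1 w 2 0]
    Hdg_mult[of v 1 1 w 1 1] Hdg_mult[of v 1 1 w 0 2] Hdg_mult[of v 0 2 w 2 0]
    Hdg_mult[of v 0 2 w 1 1] by simp_all

lemma conjugate_components:
  "v \<in> A1 \<Longrightarrow> conjugate v \<in> Am" "v \<in> A0 \<Longrightarrow> conjugate v \<in> A0" "v \<in> Am \<Longrightarrow> conjugate v \<in> A1"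
proof -
  have c: "conjugate ` A1 = Am" "conjugate ` A0 = A0"
    using hodge by (simp_all add: hodge_structure_2_def)
  show "v \<in> A1 \<Longrightarrow> conjugate v \<in> Am" "v \<in> A0 \<Longrightarrow> conjugate v \<in> A0"
    using c by auto
  assume "v \<in> Am"
  then obtain w where "w \<in> A1" "v = conjugate w" using c(1) by auto
  then show "conjugate v \<in> A1" by simp
qed

section \<open>Homogeneous components\<close>

definition components where
  "components v = (THE (a, b, c). a \<in> A1 \<and> b \<in> A0 \<and> c \<in> Am \<and> v = a + b + c)"
definition "c1 v = fst (components v)"
definition "c0 v = fst (snd (components v))"
definition "cm v = snd (snd (components v))"

lemma ex1_components: "\<exists>!(a, b, c). a \<in> A1 \<and> b \<in> A0 \<and> c \<in> Am \<and> v = a + b + c"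
  using hodge by (simp add: hodge_structure_2_def)

lemma components_in [simp]: "c1 v \<in> A1" "c0 v \<in> A0" "cm v \<in> Am"
  and components_sum: "v = c1 v + c0 v + cm v"
proof -
  have "case components v of (a, b, c) \<Rightarrow> a \<in> A1 \<and> b \<in> A0 \<and> c \<in> Am \<and> v = a + b + c"
    unfolding components_def by (rule theI'[OF ex1_components])
  then show "c1 v \<in> A1" "c0 v \<in> A0" "cm v \<in> Am" "v = c1 v + c0 v + cm v"
    by (auto simp: c1_def c0_def cm_def split: prod.splits)
qed

lemma components_eq:
  assumes "a \<in> A1" "b \<in> A0" "c \<in> Am"
  shows "c1 (a + b + c) = a" "c0 (a + b + c) = b" "cm (a + b + c) = c"
proof -
  have "components (a + b + c) = (a, b, c)"
    unfolding components_def by (rule the1_equality[OF ex1_components]) (use assms in auto)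
  then show "c1 (a + b + c) = a" "c0 (a + b + c) = b" "cm (a + b + c) = c"
    by (simp_all add: c1_def c0_def cm_def)
qed

lemma components_homogeneous:
  "a \<in> A1 \<Longrightarrow> c1 a = a \<and> c0 a = 0 \<and> cm a = 0"
  "a \<in> A0 \<Longrightarrow> c1 a = 0 \<and> c0 a = a \<and> cm a = 0"
  "a \<in> Am \<Longrightarrow> c1 a = 0 \<and> c0 a = 0 \<and> cm a = a"
  using components_eq[of a 0 0] components_eq[of 0 a 0] components_eq[of 0 0 a] by simp_all

lemma components_add: "c1 (v + w) = c1 v + c1 w" "c0 (v + w) = c0 v + c0 w" "cm (v + w) = cm v + cm w"
proof -
  have "v + w = (c1 v + c1 w) + (c0 v + c0 w) + (cm v + cm w)"
  proof -
    have "(c1 v + c1 w) + (c0 v + c0 w) + (cm v + cm w) = (c1 v + c0 v + cm v) + (c1 w + c0 w + cm w)"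
      by (simp only: ac_simps)
    then show ?thesis by (simp only: components_sum[symmetric])
  qed
  then show "c1 (v + w) = c1 v + c1 w" "c0 (v + w) = c0 v + c0 w" "cm (v + w) = cm v + cm w"
    using components_eq[of "c1 v + c1 w" "c0 v + c0 w" "cm v + cm w"] by (simp_all add: Hdg_add)
qed

lemma components_scale: "c1 (k *\<^sub>C v) = k *\<^sub>C c1 v" "c0 (k *\<^sub>C v) = k *\<^sub>C c0 v" "cm (k *\<^sub>C v) = k *\<^sub>C cm v"
proof -
  have "k *\<^sub>C v = k *\<^sub>C c1 v + k *\<^sub>C c0 v + k *\<^sub>C cm v"
    by (simp only: Cvec.scale_right_distrib[symmetric] components_sum[symmetric])
  then show "c1 (k *\<^sub>C v) = k *\<^sub>C c1 v" "c0 (k *\<^sub>C v) = k *\<^sub>C c0 v" "cm (k *\<^sub>C v) = k *\<^sub>C cm v"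
    using components_eq[of "k *\<^sub>C c1 v" "k *\<^sub>C c0 v" "k *\<^sub>C cm v"] by (simp_all add: Hdg_scale)
qed

text \<open>The degree zero part of \<open>1\<close> is already a right identity; applied to
  \<open>1\<close> itself this gives \<open>1 = c0 1\<close>.\<close>

lemma one_in_A0: "1 \<in> A0"
proof -
  \<comment> \<open>Compare the components of the degree of \<open>v\<close> in
    \<open>v = v * 1\<close>: only \<open>v * c0 1\<close> has that degree.\<close>
  have r: "v * c0 1 = v" if v: "v \<in> A1 \<or> v \<in> A0 \<or> v \<in> Am" for v
  proof -
    have e: "v * c1 1 + v * c0 1 + v * cm 1 = v"
      by (simp only: distrib_left[symmetric] components_sum[symmetric] mult.right_neutral)
    consider "v \<in> A1" | "v \<in> A0" | "v \<in> Am" using v by blast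
    then show ?thesis
    proof cases
      case 1
      then have "v * c1 1 = 0" using mult_11 by auto
      then show ?thesis using e components_eq(1)[of "v * c0 1" "v * cm 1" 0] 1
          components_homogeneous(1)[OF 1] mult_components by simp
    next
      case 2
      then show ?thesis using e components_eq(2)[of "v * c1 1" "v * c0 1" "v * cm 1"]
          components_homogeneous(2)[OF 2] mult_components by simp
    next
      case 3
      then have "v * cm 1 = 0" using mult_mm by auto
      then show ?thesis using e components_eq(3)[of 0 "v * c1 1" "v * c0 1"] 3
          components_homogeneous(3)[OF 3] mult_components by simp
    qed
  qed
  have "v * c0 1 = v" for v
  proof -
    have "v * c0 1 = c1 v * c0 1 + c0 v * c0 1 + cm v * c0 1"
      by (simp only: distrib_right[symmetric] components_sum[symmetric])
    also have "\<dots> = v"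
      by (simp add: r components_sum[symmetric])
    finally show ?thesis .
  qed
  from this[of 1] show ?thesis using components_in(2)[of 1] by simp
qed

section \<open>The Weil operator and the positive definite form\<close>

definition weil where "weil v = c1 v - c0 v + cm v"

lemma weil_add: "weil (v + w) = weil v + weil w"
  by (simp add: weil_def components_add algebra_simps)

lemma weil_scale: "weil (k *\<^sub>C v) = k *\<^sub>C weil v"
  by (simp add: weil_def components_scale Cvec.scale_right_distrib Cvec.scale_right_diff_distrib)

lemma weil_weil: "weil (weil v) = v"
proof -
  have "weil v = c1 v + (- c0 v) + cm v" by (simp add: weil_def)
  moreover have "- c0 v \<in> A0" by (rule Cvec.subspace_neg[OF subspace_Hdg]) simp
  ultimately have "c1 (weil v) = c1 v" "c0 (weil v) = - c0 v" "cm (weil v) = cm v"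
    using components_eq[of "c1 v" "- c0 v" "cm v"] by simp_all
  then show ?thesis using components_sum[of v] by (simp add: weil_def[of "weil v"])
qed

text \<open>On \<open>Hdg p q\<close> the Weil operator is i^(p-q), and \<open>weil\<close> is its
  negative; this sign cancels the negativity of \<open>h\<close> on \<open>A0\<close>.\<close>

definition ip where "ip v w = h v (weil w)"

lemma h_orthogonal:
  "v \<in> Hdg p q \<Longrightarrow> w \<in> Hdg r s \<Longrightarrow> (p, q) \<noteq> (r, s) \<Longrightarrow> h v w = 0"
  using polarization unfolding polarizes_2_def by blast

lemma h_cnj: "cnj (h v w) = h w v"
  using extend_form_cnj[OF bilinear_form, of v "conjugate w"]
    extend_form_swap[OF bilinear_form bilinear_form, of 1 "conjugate v" w]
  by (simp add: hermitian_form_def form_sym)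

lemma h_positive:
  "v \<in> A1 \<Longrightarrow> v \<noteq> 0 \<Longrightarrow> 0 < Re (h v v)"
  "v \<in> A0 \<Longrightarrow> v \<noteq> 0 \<Longrightarrow> Re (h v v) < 0"
  "v \<in> Am \<Longrightarrow> v \<noteq> 0 \<Longrightarrow> 0 < Re (h v v)"
  using polarization by (auto simp: polarizes_2_def positive_definite_on_def)

lemma h_components: "h (c1 v) w = h (c1 v) (c1 w)" "h (c0 v) w = h (c0 v) (c0 w)" "h (cm v) w = h (cm v) (cm w)"
proof -
  have "h x w = h x (c1 w) + h x (c0 w) + h x (cm w)" for x
    by (simp only: hermitian_form_simps(2)[symmetric] components_sum[symmetric])
  moreover have "h (c1 v) (c0 w) = 0" "h (c1 v) (cm w) = 0" "h (c0 v) (c1 w) = 0"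
     "h (c0 v) (cm w) = 0" "h (cm v) (c1 w) = 0" "h (cm v) (c0 w) = 0"
    by (simp_all add: h_orthogonal[OF components_in(1) components_in(2)] h_orthogonal[OF components_in(1) components_in(3)]
      h_orthogonal[OF components_in(2) components_in(1)] h_orthogonal[OF components_in(2) components_in(3)]
      h_orthogonal[OF components_in(3) components_in(1)] h_orthogonal[OF components_in(3) components_in(2)])
  ultimately show "h (c1 v) w = h (c1 v) (c1 w)" "h (c0 v) w = h (c0 v) (c0 w)" "h (cm v) w = h (cm v) (cm w)"
    by simp_all
qed

lemma ip_components: "ip v w = h (c1 v) (c1 w) - h (c0 v) (c0 w) + h (cm v) (cm w)"
proof -
  have "weil w = c1 w + (- c0 w) + cm w" by (simp add: weil_def)
  moreover have "- c0 w \<in> A0" by (rule Cvec.subspace_neg[OF subspace_Hdg]) simp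
  ultimately have c: "c1 (weil w) = c1 w" "c0 (weil w) = - c0 w" "cm (weil w) = cm w"
    using components_eq[of "c1 w" "- c0 w" "cm w"] by simp_all
  have "ip v w = h (c1 v) (weil w) + h (c0 v) (weil w) + h (cm v) (weil w)"
    by (simp only: ip_def hermitian_form_simps(1)[symmetric] components_sum[symmetric])
  then show ?thesis by (simp add: h_components[of v "weil w"] c)
qed

sublocale hs: hermitian_space scaleC ip
proof
  fix v w x :: "'h complexification" and c
  show "ip (v + w) x = ip v x + ip w x" "ip (c *\<^sub>C v) x = c * ip v x"
    by (simp_all add: ip_def hermitian_form_simps)
  show "cnj (ip v w) = ip w v"
    by (simp add: ip_components h_cnj)
  show "\<exists>D :: 'h complexification set. finite D \<and> Cvec.span D = UNIV"
    by (rule finite_dim_complexification)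
  assume v: "v \<noteq> 0"
  have nn: "0 \<le> Re (h (c1 v) (c1 v))" "Re (h (c0 v) (c0 v)) \<le> 0" "0 \<le> Re (h (cm v) (cm v))"
    using h_positive(1)[of "c1 v"] h_positive(2)[of "c0 v"] h_positive(3)[of "cm v"]
    by (cases "c1 v = 0"; cases "c0 v = 0"; cases "cm v = 0"; simp)+
  have "c1 v \<noteq> 0 \<or> c0 v \<noteq> 0 \<or> cm v \<noteq> 0"
    using v components_sum[of v] by auto
  then show "0 < Re (ip v v)"
    using nn h_positive(1)[of "c1 v"] h_positive(2)[of "c0 v"] h_positive(3)[of "cm v"]
    by (auto simp: ip_components)
qed

text \<open>Testing against \<open>x = weil w\<close> gives \<open>ip w w = 0\<close>.\<close>

lemma h_nondegenerate: "(\<And>x. h x w = 0) \<Longrightarrow> w = 0"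
  using hs.ip_self_eq_0[of w] h_cnj[of "weil w" w] by (simp add: ip_def)

section \<open>The adjoint involution\<close>

definition hat where "hat v = conjugate (extend_map t v)"

lemma hat_tensor: "hat (x \<otimes>\<^sub>C c) = t x \<otimes>\<^sub>C cnj c"
  by (simp add: hat_def extend_map_tensor[OF t_linear])

lemma hat_add: "hat (v + w) = hat v + hat w"
  by (simp add: hat_def extend_map_add)

lemma hat_hat: "hat (hat v) = v"
  by (induction v rule: complexification_induct) (simp_all add: hat_tensor hat_add t_involutive)

lemma hat_conjugate: "hat (conjugate v) = conjugate (hat v)"
  by (induction v rule: complexification_induct) (simp_all add: hat_tensor hat_add)

lemma hat_scale: "hat (c *\<^sub>C v) = cnj c *\<^sub>C hat v"
  by (induction v rule: complexification_induct)
     (simp_all add: hat_tensor hat_add scaleC_tensor Cvec.scale_right_distrib)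

lemma extend_form_adjoint:
  "extend_form form (v * x) y = extend_form form x (extend_map t v * y)"
  "extend_form form (x * v) y = extend_form form x (y * extend_map t v)"
proof -
  have "extend_form form (v * x) y = extend_form form x (extend_map t v * y) \<and>
    extend_form form (x * v) y = extend_form form x (y * extend_map t v)"
  proof (induction v rule: complexification_induct)
    case (tensor v c)
    show ?case
    proof (induction x rule: complexification_induct)
      case (tensor x d)
      show ?case
        by (induction y rule: complexification_induct)
          (simp_all add: tensor_times_tensor extend_map_tensor[OF t_linear] distrib_left distrib_right
            extend_form_add_right extend_form_tensor[OF bilinear_form] t_adjoint_left[of v] t_adjoint_right[of x v])
    qed (simp_all add: distrib_left distrib_right extend_form_add_left)
  qed (simp_all add: distrib_left distrib_right extend_form_add_left extend_form_add_right extend_map_add)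
  then show "extend_form form (v * x) y = extend_form form x (extend_map t v * y)"
    "extend_form form (x * v) y = extend_form form x (y * extend_map t v)" by auto
qed

lemma h_adjoint: "h (v * x) y = h x (hat v * y)" "h (x * v) y = h x (y * hat v)"
  by (simp_all add: hermitian_form_def hat_def extend_form_adjoint(1)[of v] extend_form_adjoint(2)[of x v])

lemma h_diff_right: "h x (v - w) = h x v - h x w"
  using hermitian_form_simps(2)[of form x "v - w" w] by simp

text \<open>Left multiplication by \<open>v * w\<close> is a composition, so its adjoint is the
  composition of the adjoints in reverse order; evaluate at \<open>1\<close> and use
  nondegeneracy.\<close>

lemma hat_mult: "hat (v * w) = hat w * hat v"
proof -
  have "h x (hat (v * w) - hat w * hat v) = 0" for x
  proof -
    have "h x (hat (v * w)) = h (v * w * x) 1" by (simp add: h_adjoint)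
    also have "\<dots> = h x (hat w * hat v)" by (simp add: mult.assoc h_adjoint)
    finally show ?thesis by (simp add: h_diff_right)
  qed
  then show ?thesis using h_nondegenerate[of "hat (v * w) - hat w * hat v"] by simp
qed

lemma component_eq_0:
  "h (c1 z) z = 0 \<Longrightarrow> c1 z = 0" "h (c0 z) z = 0 \<Longrightarrow> c0 z = 0" "h (cm z) z = 0 \<Longrightarrow> cm z = 0"
  using h_components[of z z] h_positive(1)[of "c1 z"] h_positive(2)[of "c0 z"] h_positive(3)[of "cm z"]
  by auto

text \<open>Moving \<open>hat v\<close> across turns the pairing into that of \<open>v * w\<close>
  with \<open>1\<close>, and \<open>1\<close> has degree zero.\<close>

lemma hat_pairing:
  assumes "v \<in> Hdg p q" "w \<in> Hdg r s" "(p + r, q + s) \<noteq> (2, 2)"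
  shows "h w (hat v) = 0"
proof -
  have "h w (hat v) = h (v * w) 1" by (simp add: h_adjoint)
  also have "\<dots> = 0"
    by (rule h_orthogonal[OF Hdg_mult[OF assms(1,2)] one_in_A0]) (use assms(3) in auto)
  finally show ?thesis .
qed

text \<open>Each component of \<open>hat v\<close> of the wrong degree pairs to zero with
  \<open>hat v\<close> by \<open>hat_pairing\<close>, hence has square norm zero for a definite
  form.\<close>

lemma hat_components: "v \<in> A1 \<Longrightarrow> hat v \<in> Am" "v \<in> A0 \<Longrightarrow> hat v \<in> A0" "v \<in> Am \<Longrightarrow> hat v \<in> A1"
proof -
  assume v: "v \<in> A1"
  have "c1 (hat v) = 0" "c0 (hat v) = 0"
    using component_eq_0(1,2)[of "hat v"] hat_pairing[OF v components_in(1)[of "hat v"]]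
      hat_pairing[OF v components_in(2)[of "hat v"]] by simp_all
  then show "hat v \<in> Am" using components_sum[of "hat v"] components_in(3)[of "hat v"] by simp
next
  assume v: "v \<in> A0"
  have "c1 (hat v) = 0" "cm (hat v) = 0"
    using component_eq_0(1,3)[of "hat v"] hat_pairing[OF v components_in(1)[of "hat v"]]
      hat_pairing[OF v components_in(3)[of "hat v"]] by simp_all
  then show "hat v \<in> A0" using components_sum[of "hat v"] components_in(2)[of "hat v"] by simp
next
  assume v: "v \<in> Am"
  have "c0 (hat v) = 0" "cm (hat v) = 0"
    using component_eq_0(2,3)[of "hat v"] hat_pairing[OF v components_in(2)[of "hat v"]]
      hat_pairing[OF v components_in(3)[of "hat v"]] by simp_all
  then show "hat v \<in> A1" using components_sum[of "hat v"] components_in(1)[of "hat v"] by simp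
qed

section \<open>The ideal of \<open>A0\<close> generated by products of degrees 1 and -1\<close>

definition J where "J = Cvec.span {a * b | a b. a \<in> A1 \<and> b \<in> Am}"

lemma J_induct [consumes 1, case_names mult add]:
  assumes "w \<in> J" "\<And>a b. a \<in> A1 \<Longrightarrow> b \<in> Am \<Longrightarrow> P (a * b)"
    "\<And>v w. P v \<Longrightarrow> P w \<Longrightarrow> P (v + w)"
  shows "P w"
  using assms(1) unfolding J_def
proof (induction rule: Cvec.span_induct_alt)
  case base
  show ?case using assms(2)[of 0 0] by simp
next
  case (step c x y)
  then obtain a b where "a \<in> A1" "b \<in> Am" "x = a * b" by blast
  then have "P (c *\<^sub>C x)" using assms(2)[of "c *\<^sub>C a" b] by (simp add: Hdg_scale scaleC_mult_left)
  then show ?case using step assms(3) by blast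
qed

lemma J_mult: "a \<in> A1 \<Longrightarrow> b \<in> Am \<Longrightarrow> a * b \<in> J"
  unfolding J_def by (rule Cvec.span_base) blast

lemma J_add: "v \<in> J \<Longrightarrow> w \<in> J \<Longrightarrow> v + w \<in> J"
  unfolding J_def by (rule Cvec.span_add)

lemma J_diff: "v \<in> J \<Longrightarrow> w \<in> J \<Longrightarrow> v - w \<in> J"
  unfolding J_def by (rule Cvec.span_diff)

lemma J_subset_A0: "w \<in> J \<Longrightarrow> w \<in> A0"
  by (induction rule: J_induct) (auto intro: mult_components Hdg_add)

text \<open>In a product \<open>a * b\<close> a factor from \<open>A0\<close> on the right is
  absorbed by \<open>b\<close> and one on the left by \<open>a\<close>.\<close>

lemma J_mult_A0: "w \<in> J \<Longrightarrow> b \<in> A0 \<Longrightarrow> w * b \<in> J" "w \<in> J \<Longrightarrow> b \<in> A0 \<Longrightarrow> b * w \<in> J"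
proof -
  show "w * b \<in> J" if "w \<in> J" "b \<in> A0"
    using that(1)
    by (induction rule: J_induct)
       (auto simp: distrib_right mult.assoc intro!: J_mult J_add mult_components that(2))
  show "b * w \<in> J" if "w \<in> J" "b \<in> A0"
    using that(1)
    by (induction rule: J_induct)
       (auto simp: distrib_left mult.assoc[symmetric] intro!: J_mult J_add mult_components that(2))
qed

lemma J_hat: "w \<in> J \<Longrightarrow> hat w \<in> J"
  by (induction rule: J_induct) (auto simp: hat_mult hat_add intro!: J_mult J_add hat_components)

text \<open>Reassociating puts two factors of degree 1, or two of degree -1, next to each
  other.\<close>

lemma mult_J_zero: "w \<in> J \<Longrightarrow> a \<in> A1 \<Longrightarrow> a * w = 0" "w \<in> J \<Longrightarrow> b \<in> Am \<Longrightarrow> w * b = 0"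
  by (induction rule: J_induct) (auto simp: distrib_left distrib_right mult.assoc mult_mm,
       simp add: mult.assoc[symmetric] mult_11)

section \<open>The idempotents \<open>p\<close> and \<open>u\<close>\<close>

definition p where "p = (SOME p. p \<in> J \<and> (\<forall>w\<in>J. ip (1 - p) w = 0))"

lemma p_in_J: "p \<in> J" and p_orthogonal: "w \<in> J \<Longrightarrow> ip (1 - p) w = 0"
proof -
  have "\<exists>p. p \<in> J \<and> (\<forall>w\<in>J. ip (1 - p) w = 0)"
    using hs.projection[of _ 1] unfolding J_def by blast
  then have "p \<in> J \<and> (\<forall>w\<in>J. ip (1 - p) w = 0)" unfolding p_def by (rule someI_ex)
  then show "p \<in> J" "w \<in> J \<Longrightarrow> ip (1 - p) w = 0" by auto
qed

lemma p_in_A0: "p \<in> A0"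
  using p_in_J by (rule J_subset_A0)

lemma weil_A0: "v \<in> A0 \<Longrightarrow> weil v = - v"
  by (simp add: weil_def components_homogeneous)

text \<open>The defect \<open>v = a - p * a\<close> satisfies
  \<open>h v v = h (1 - p) (v * hat a)\<close>, where \<open>v * hat a\<close> lies in
  \<open>J\<close> and \<open>1 - p\<close> is orthogonal to \<open>J\<close>. Positivity of
  \<open>h\<close> on \<open>A1\<close> forces \<open>v = 0\<close>.\<close>

lemma p_mult_A1: assumes a: "a \<in> A1" shows "p * a = a"
proof -
  define v where "v = a - p * a"
  have v: "v \<in> A1" unfolding v_def using a p_in_A0 by (intro Hdg_diff mult_components)
  have ah: "a * hat a \<in> J" using a by (intro J_mult hat_components)
  have vJ: "v * hat a \<in> J"
  proof -
    have "v * hat a = a * hat a - p * (a * hat a)" by (simp add: v_def left_diff_distrib mult.assoc)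
    then show ?thesis using ah J_mult_A0(2)[OF ah p_in_A0] J_diff by metis
  qed
  have "h v v = h ((1 - p) * a) v" by (simp add: v_def left_diff_distrib)
  also have "\<dots> = h (1 - p) (v * hat a)" by (rule h_adjoint)
  also have "\<dots> = - ip (1 - p) (v * hat a)" using J_subset_A0[OF vJ] by (simp add: ip_def weil_A0)
  also have "\<dots> = 0" by (simp add: p_orthogonal[OF vJ])
  finally have "v = 0" using h_positive(1)[OF v] by auto
  then show ?thesis by (simp add: v_def)
qed

lemma A1_mult_p: "a \<in> A1 \<Longrightarrow> a * p = 0"
  using p_in_J by (rule mult_J_zero)

lemma p_mult_Am: "b \<in> Am \<Longrightarrow> p * b = 0"
  using p_in_J by (rule mult_J_zero)

lemma p_mult_J: "w \<in> J \<Longrightarrow> p * w = w"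
  by (induction rule: J_induct) (auto simp: p_mult_A1 mult.assoc[symmetric] distrib_left)

lemma p_idem: "p * p = p"
  using p_in_J by (rule p_mult_J)

text \<open>As a left identity of \<open>J\<close>, \<open>p\<close> satisfies
  \<open>p * hat p = hat p\<close>; the left side is fixed by \<open>hat\<close>, the right side
  becomes \<open>p\<close>.\<close>

lemma hat_p: "hat p = p"
proof -
  have e: "p * hat p = hat p" using J_hat[OF p_in_J] by (rule p_mult_J)
  have "p * hat p = p" using arg_cong[OF e, of hat] by (simp only: hat_mult hat_hat)
  then show ?thesis using e by simp
qed

lemma Am_mult_p: assumes "b \<in> Am" shows "b * p = b"
proof -
  have "hat (p * hat b) = hat (hat b)" using p_mult_A1[OF hat_components(3)[OF assms]] by simp
  then show ?thesis by (simp add: hat_mult hat_hat hat_p)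
qed

lemma J_mult_p: "w \<in> J \<Longrightarrow> w * p = w"
  by (induction rule: J_induct) (auto simp: Am_mult_p mult.assoc distrib_right)

text \<open>Since \<open>J\<close> is an ideal of \<open>A0\<close> with two-sided identity
  \<open>p\<close>, both sides equal \<open>p * b * p\<close>.\<close>

lemma p_commute_A0: "b \<in> A0 \<Longrightarrow> p * b = b * p"
  using p_mult_J[OF J_mult_A0(2)[OF p_in_J, of b]] J_mult_p[OF J_mult_A0(1)[OF p_in_J, of b]]
  by (simp add: mult.assoc)

abbreviation pb where "pb \<equiv> conjugate p"

lemma pb_rules:
  "b \<in> Am \<Longrightarrow> pb * b = b" "b \<in> Am \<Longrightarrow> b * pb = 0" "a \<in> A1 \<Longrightarrow> pb * a = 0"
  "a \<in> A1 \<Longrightarrow> a * pb = a" "v \<in> A0 \<Longrightarrow> pb * v = v * pb"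
  using arg_cong[OF p_mult_A1[of "conjugate b"], of conjugate] arg_cong[OF A1_mult_p[of "conjugate b"], of conjugate]
    arg_cong[OF p_mult_Am[of "conjugate a"], of conjugate] arg_cong[OF Am_mult_p[of "conjugate a"], of conjugate]
    arg_cong[OF p_commute_A0[of "conjugate v"], of conjugate] conjugate_components
  by simp_all

text \<open>A conjugated element of \<open>J\<close> is a sum of products starting with a factor of
  degree -1, and \<open>p\<close> kills these factors from the left.\<close>

lemma p_mult_pb: "p * pb = 0"
proof -
  have "p * conjugate w = 0" if "w \<in> J" for w
    using that
    by (induction rule: J_induct)
       (auto simp: distrib_left mult.assoc[symmetric] p_mult_Am conjugate_components)
  then show ?thesis using p_in_J by blast
qed

lemma pb_mult_p: "pb * p = 0"
  using arg_cong[OF p_mult_pb, of conjugate] by simp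

lemma pb_idem: "pb * pb = pb"
  using arg_cong[OF p_idem, of conjugate] by simp

definition u where "u = p + pb"

lemma conjugate_u: "conjugate u = u"
  by (simp add: u_def add.commute)

lemma hat_u: "hat u = u"
  by (simp add: u_def hat_add hat_conjugate hat_p)

lemma u_mult: "a \<in> A1 \<union> Am \<Longrightarrow> u * a = a" "a \<in> A1 \<union> Am \<Longrightarrow> a * u = a"
  by (auto simp: u_def distrib_left distrib_right p_mult_A1 p_mult_Am A1_mult_p Am_mult_p pb_rules)

lemma u_central: "u * v = v * u"
proof -
  have "u * c1 v = c1 v * u" "u * cm v = cm v * u" using u_mult by auto
  moreover have "u * c0 v = c0 v * u"
    by (simp add: u_def distrib_left distrib_right p_commute_A0 pb_rules)
  moreover have "v * u = c1 v * u + c0 v * u + cm v * u" "u * v = u * c1 v + u * c0 v + u * cm v"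
    by (simp_all only: distrib_right[symmetric] distrib_left[symmetric] components_sum[symmetric])
  ultimately show ?thesis by simp
qed

lemma u_p: "u * p = p"
  by (simp add: u_def distrib_right p_idem pb_mult_p)

lemma extend_map_u: "extend_map t u = u"
  using hat_u conjugate_u by (metis conjugate_conjugate hat_def)

text \<open>The right ideal generated by \<open>p\<close> consists of \<open>A1\<close> and of
  \<open>A0\<close> times \<open>p\<close>; right multiplication by \<open>p - pb\<close> is -1 on
  the former and 1 on the latter. Thus the Weil operator becomes multiplication by an element that
  rational elements can approximate.\<close>

lemma weil_on_p: assumes "p * w = w" shows "weil w = - (w * (p - pb))"
proof -
  have "w = p * c1 w + p * c0 w + p * cm w"
    by (simp only: distrib_left[symmetric] components_sum[symmetric] assms)
  then have w: "w = c1 w + c0 w * p + 0" by (simp add: p_mult_A1 p_mult_Am p_commute_A0)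
  note eq = components_eq[of "c1 w" "c0 w * p" 0, OF components_in(1) mult_components(4)[OF components_in(2) p_in_A0] Hdg_zero]
  have c: "c0 w = c0 w * p" "cm w = 0"
    using eq(2) by (simp only: w[symmetric]) (use eq(3) in \<open>simp only: w[symmetric]\<close>)
  have "c0 w * pb = c0 w * (p * pb)" by (subst c(1)) (simp only: mult.assoc)
  then have "c0 w * (p - pb) = c0 w" using c(1) by (simp add: right_diff_distrib p_mult_pb)
  moreover have "c1 w * (p - pb) = - c1 w" by (simp add: right_diff_distrib A1_mult_p pb_rules)
  moreover have "w * (p - pb) = c1 w * (p - pb) + c0 w * (p - pb) + cm w * (p - pb)"
    by (simp only: distrib_right[symmetric] components_sum[symmetric])
  ultimately have "w * (p - pb) = c0 w - c1 w" by (simp add: c(2))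
  then show ?thesis by (simp add: weil_def c(2))
qed

end

section \<open>Rational skew elements\<close>

lemma rational_near_real:
  fixes x e :: real
  assumes "e > 0"
  shows "\<exists>q. \<bar>of_rat q - x\<bar> < e"
proof -
  obtain q where "x < of_rat q" "of_rat q < x + e" using of_rat_dense[of x "x + e"] assms by auto
  then show ?thesis by (intro exI[of _ q]) auto
qed

context hodge_algebra
begin

lemma exists_skew_positive:
  "\<exists>s. t s = - s \<and> (\<forall>w. w \<noteq> 0 \<longrightarrow> p * w = w \<longrightarrow> 0 < Re (\<i> * h w (w * (s \<otimes>\<^sub>C 1))))"
proof -
  interpret t: Vector_Spaces.linear scaleQ scaleQ t by (rule t_linear)
  \<comment> \<open>The factor makes \<open>v0\<close> real under conjugation and anti-invariant
    under \<open>t\<close>.\<close>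
  define v0 where "v0 = (- \<i>) *\<^sub>C (p - pb)"
  have cv0: "conjugate v0 = v0" by (simp add: v0_def Cvec.scale_right_diff_distrib)
  define r where "r b = Re (coord b v0)" for b
  \<comment> \<open>Anti-invariant parts of the basis vectors: \<open>v0\<close> is a real
    combination of the \<open>d b\<close>, and every rational combination of them comes from a
    rational skew element.\<close>
  define d where "d b = ((1/2) *\<^sub>Q (b - t b)) \<otimes>\<^sub>C 1" for b
  have exp: "v0 = (\<Sum>b\<in>B. b \<otimes>\<^sub>C of_real (r b))"
    unfolding r_def by (rule conjugate_real_part[OF cv0])
  have "hat v0 = - v0"
  proof -
    have "hat (p - pb) + pb = p"
      using hat_add[of "p - pb" pb] by (simp add: hat_p hat_conjugate)
    then have hp: "hat (p - pb) = p - pb" by (simp add: eq_diff_eq)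
    show ?thesis unfolding v0_def hat_scale hp by simp
  qed
  then have "extend_map t v0 = - v0"
    using cv0 by (metis conjugate_conjugate conjugate_minus hat_def)
  then have tv0: "(\<Sum>b\<in>B. t b \<otimes>\<^sub>C of_real (r b)) = - v0"
    by (subst (asm) exp) (simp only: extend_map_sum extend_map_tensor[OF t_linear])
  have d: "k *\<^sub>C d b = (1/2) *\<^sub>C (b \<otimes>\<^sub>C k - t b \<otimes>\<^sub>C k)" for b k
  proof -
    have "t b \<otimes>\<^sub>C x + (b - t b) \<otimes>\<^sub>C x = b \<otimes>\<^sub>C x" for x
      using tensor_add_left[of "t b" "b - t b" x] by simp
    then have "(b - t b) \<otimes>\<^sub>C x = b \<otimes>\<^sub>C x - t b \<otimes>\<^sub>C x" for x by (simp add: eq_diff_eq add.commute)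
    then show ?thesis by (simp add: d_def tensor_scaleQ scaleC_tensor Cvec.scale_right_diff_distrib of_rat_divide)
  qed
  have v0: "v0 = (\<Sum>b\<in>B. of_real (r b) *\<^sub>C d b)"
  proof -
    have "(\<Sum>b\<in>B. of_real (r b) *\<^sub>C d b) = (1/2) *\<^sub>C (v0 - (- v0))"
      unfolding d by (simp only: Cvec.scale_sum_right[symmetric] sum_subtractf tv0 exp[symmetric])
    also have "\<dots> = (1/2) *\<^sub>C (2 *\<^sub>C v0)"
      using Cvec.scale_left_distrib[of 1 1 v0] by simp
    finally show ?thesis by simp
  qed
  have "\<exists>M\<ge>0. \<forall>w. \<bar>Re (\<i> * h w (w * d b))\<bar> \<le> M * Re (ip w w)" for b
  proof -
    \<comment> \<open>As \<open>weil\<close> is an involution, the perturbation terms are values of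
      \<open>ip w (F w)\<close> for linear \<open>F\<close>, to which the numerical range bound
      applies.\<close>
    have "ip w ((- \<i>) *\<^sub>C weil (w * d b)) = \<i> * h w (w * d b)" for w
      by (simp only: ip_def weil_scale weil_weil hermitian_form_simps) simp
    then show ?thesis
      using hs.numerical_range_bounded[of "\<lambda>w. (- \<i>) *\<^sub>C weil (w * d b)"]
      by (simp only: weil_add weil_scale distrib_right scaleC_mult_left Cvec.scale_right_distrib Cvec.scale_left_commute)
  qed
  then obtain M where M: "\<And>b. M b \<ge> 0" "\<And>b w. \<bar>Re (\<i> * h w (w * d b))\<bar> \<le> M b * Re (ip w w)"
    by metis
  \<comment> \<open>With coefficient errors below \<open>e\<close> the total error is at most
    \<open>e * (\<Sum>b\<in>B. M b)\<close> times the square norm of \<open>w\<close>, and this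
    factor is less than 1.\<close>
  define e where "e = 1 / (1 + (\<Sum>b\<in>B. M b))"
  have S0: "0 \<le> (\<Sum>b\<in>B. M b)" using M(1) by (simp add: sum_nonneg)
  then have e: "e > 0" by (simp add: e_def)
  have "\<exists>q. \<forall>b. \<bar>of_rat (q b) - r b\<bar> < e" by (intro choice allI rational_near_real e)
  then obtain q where q: "\<And>b. \<bar>of_rat (q b) - r b\<bar> < e" by blast
  define s where "s = (\<Sum>b\<in>B. q b *\<^sub>Q (1/2) *\<^sub>Q (b - t b))"
  have "t s = - s"
    by (simp add: s_def t.sum t.scale t.diff t_involutive sum_negf[symmetric]
        Qvec.scale_minus_right[symmetric] del: Qvec.scale_minus_right)
  moreover have "0 < Re (\<i> * h w (w * (s \<otimes>\<^sub>C 1)))" if w: "w \<noteq> 0" "p * w = w" for w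
  proof -
    have rat: "of_rat k = complex_of_real (of_rat k)" for k
      by (cases k) (simp add: of_rat_rat)
    have "s \<otimes>\<^sub>C 1 = (\<Sum>b\<in>B. of_rat (q b) *\<^sub>C d b)"
      by (simp add: s_def tensor_sum_left tensor_scaleQ d_def scaleC_tensor of_rat_mult[symmetric] mult.commute)
    also have "\<dots> = v0 + (\<Sum>b\<in>B. of_real (of_rat (q b) - r b) *\<^sub>C d b)"
      by (simp add: v0 sum.distrib[symmetric] Cvec.scale_left_distrib[symmetric] rat)
    finally have s: "s \<otimes>\<^sub>C 1 = v0 + (\<Sum>b\<in>B. of_real (of_rat (q b) - r b) *\<^sub>C d b)" .
    have hsum: "h w (sum f I) = (\<Sum>b\<in>I. h w (f b))" for f and I :: "'h set"
      by (induction I rule: infinite_finite_induct) (simp_all add: hermitian_form_simps)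
    \<comment> \<open>At \<open>v0\<close> itself the form is exactly the positive definite
      one.\<close>
    have "\<i> * h w (w * v0) = ip w w"
      using weil_on_p[OF w(2)] by (simp add: v0_def scaleC_mult_right hermitian_form_simps ip_def)
    then have "\<i> * h w (w * (s \<otimes>\<^sub>C 1)) = ip w w + (\<Sum>b\<in>B. of_real (of_rat (q b) - r b) * (\<i> * h w (w * d b)))"
      by (simp add: s distrib_left sum_distrib_left hermitian_form_simps scaleC_mult_right hsum mult.left_commute)
    then have "Re (\<i> * h w (w * (s \<otimes>\<^sub>C 1))) =
        Re (ip w w) + (\<Sum>b\<in>B. (of_rat (q b) - r b) * Re (\<i> * h w (w * d b)))"
      by simp
    moreover have "\<bar>\<Sum>b\<in>B. (of_rat (q b) - r b) * Re (\<i> * h w (w * d b))\<bar> \<le> (\<Sum>b\<in>B. e * (M b * Re (ip w w)))"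
      unfolding abs_mult
      by (intro order.trans[OF sum_abs] sum_mono)
         (simp only: abs_mult, intro mult_mono less_imp_le[OF q] M(2) abs_ge_zero less_imp_le[OF e])
    moreover have "(\<Sum>b\<in>B. e * (M b * Re (ip w w))) = (e * (\<Sum>b\<in>B. M b)) * Re (ip w w)"
      by (simp add: sum_distrib_left sum_distrib_right mult.assoc)
    moreover have "(e * (\<Sum>b\<in>B. M b)) * Re (ip w w) < 1 * Re (ip w w)"
      using S0 hs.ip_pos[OF w(1)] by (intro mult_strict_right_mono) (auto simp: e_def)
    ultimately show ?thesis by linarith
  qed
  ultimately show ?thesis by blast
qed

section \<open>Contraction of complexified algebra elements\<close>

lemma contract_mult:
  assumes "\<And>c d. l (c + d) = l c + l d" "\<And>q c. l (of_rat q * c) = q * l c"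
  shows "contract l (v * (x \<otimes>\<^sub>C 1)) = contract l v * x"
    and "contract l ((x \<otimes>\<^sub>C 1) * v) = x * contract l v"
    and "contract l (extend_map t v) = t (contract l v)"
proof -
  interpret t: Vector_Spaces.linear scaleQ scaleQ t by (rule t_linear)
  show "contract l (v * (x \<otimes>\<^sub>C 1)) = contract l v * x"
    by (induction v rule: complexification_induct)
       (simp_all add: tensor_times_tensor contract_tensor[OF assms(2)] contract_add[OF assms(1)] mult_scaleQ_left distrib_right)
  show "contract l ((x \<otimes>\<^sub>C 1) * v) = x * contract l v"
    by (induction v rule: complexification_induct)
       (simp_all add: tensor_times_tensor contract_tensor[OF assms(2)] contract_add[OF assms(1)] mult_scaleQ_right distrib_left)
  show "contract l (extend_map t v) = t (contract l v)"
    by (induction v rule: complexification_induct)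
       (simp_all add: extend_map_tensor[OF t_linear] contract_tensor[OF assms(2)] contract_add[OF assms(1)] extend_map_add t.scale t.add)
qed

lemma contract_zero: "(\<And>c d. l (c + d) = l c + l d) \<Longrightarrow> contract l 0 = 0"
  using contract_add[of l 0 0] by simp

text \<open>Contraction commutes with rational multiplications and with \<open>t\<close>, so it
  carries centrality and \<open>t\<close>-invariance of \<open>u\<close> over to a rational element;
  this is where the field in the hypothesis is reached.\<close>

lemma contract_u:
  assumes "\<And>c d. l (c + d) = l c + l d" "\<And>q c. l (of_rat q * c) = q * l c"
  shows "contract l u \<in> {z \<in> center. t z = z}"
  using contract_mult[OF assms, where v = u] u_central by (auto simp: center_def extend_map_u)

end

section \<open>The weight one structure\<close>

text \<open>The element \<open>s\<close> is the one supplied by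
  \<open>exists_skew_positive\<close>.\<close>

locale hodge_algebra_field = hodge_algebra +
  fixes s
  assumes field: "number_field {z \<in> center. t z = z}"
    and A1_nonzero: "Hdg 2 0 \<noteq> {0}"
    and t_s: "t s = - s"
    and s_pos: "\<And>w. w \<noteq> 0 \<Longrightarrow> p * w = w \<Longrightarrow> 0 < Re (\<i> * h w (w * (s \<otimes>\<^sub>C 1)))"
begin

abbreviation sC where "sC \<equiv> s \<otimes>\<^sub>C 1"

lemma hat_sC: "hat sC = - sC"
  using tensor_add_left[of s "- s" 1] by (simp add: hat_tensor t_s eq_neg_iff_add_eq_0 add.commute)

lemma u_nonzero: "u \<noteq> 0"
proof -
  obtain a where "a \<in> A1" "a \<noteq> 0" using A1_nonzero Hdg_zero by blast
  then show ?thesis using u_mult(1)[of a] by auto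
qed

section \<open>Injectivity of right multiplication by \<open>s\<close>\<close>

lemma mult_sC_p: assumes "w * sC = 0" shows "p * w = 0"
proof (rule ccontr)
  assume "p * w \<noteq> 0"
  moreover have "p * (p * w) = p * w" by (simp add: mult.assoc[symmetric] p_idem)
  ultimately have "0 < Re (\<i> * h (p * w) (p * w * sC))" by (rule s_pos)
  then show False by (simp add: mult.assoc assms)
qed

text \<open>As \<open>sC\<close> is real, \<open>conjugate w\<close> is killed as well, which adds
  the statement for \<open>pb\<close> to the one for \<open>p\<close>.\<close>

lemma mult_sC_u: assumes "w * sC = 0" shows "u * w = 0"
proof -
  have "conjugate w * sC = 0" using arg_cong[OF assms, of conjugate] by simp
  then have "conjugate (p * conjugate w) = 0" using mult_sC_p by simp
  then show ?thesis using mult_sC_p[OF assms] by (simp add: u_def distrib_right)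
qed

lemma mult_s_injective: assumes "x * s = 0" shows "x = 0"
proof -
  obtain l where l: "\<And>c d. l (c + d) = l c + l d" "\<And>q c. l (of_rat q * c) = q * l c"
    and nz: "contract l u \<noteq> 0" using contract_nonzero[OF u_nonzero] by blast
  have "(x \<otimes>\<^sub>C 1) * sC = 0" by (simp add: tensor_times_tensor assms)
  then have "u * (x \<otimes>\<^sub>C 1) = 0" by (rule mult_sC_u)
  \<comment> \<open>The nonzero contraction of \<open>u\<close> lies in the field, so it is
    invertible and kills \<open>x\<close> only if \<open>x = 0\<close>.\<close>
  then have z: "contract l u * x = 0" using contract_mult(1)[OF l, of u x] by (simp add: contract_zero[OF l(1)])
  define k where "k = contract l u"
  have k: "k \<in> {z \<in> center. t z = z}" unfolding k_def by (rule contract_u[OF l])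
  have "\<forall>x\<in>{z \<in> center. t z = z}. x \<noteq> 0 \<longrightarrow> (\<exists>y\<in>{z \<in> center. t z = z}. x * y = 1)"
    using field unfolding number_field_def by (elim conjE)
  then obtain y where "k * y = 1" using k nz unfolding k_def by metis
  then have "y * k = 1" using k by (auto simp: center_def)
  then have "x = y * (k * x)" by (simp add: mult.assoc[symmetric])
  then show ?thesis using z by (simp add: k_def)
qed

text \<open>A nonzero \<open>v\<close> has a nonzero contraction, a rational vector still killed by
  \<open>s\<close>.\<close>

lemma mult_sC_injective: assumes "v * sC = 0" shows "v = 0"
proof (rule ccontr)
  assume "v \<noteq> 0"
  then obtain l where l: "\<And>c d. l (c + d) = l c + l d" "\<And>q c. l (of_rat q * c) = q * l c"
    and nz: "contract l v \<noteq> 0" using contract_nonzero by blast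
  have "contract l v * s = 0"
    using contract_mult(1)[OF l, of v s] by (simp add: assms contract_zero[OF l(1)])
  then show False using nz mult_s_injective by blast
qed

section \<open>The complementary ideal and the operator \<open>T\<close>\<close>

definition S where "S = {v. u * v = 0}"
definition T where "T v = \<i> *\<^sub>C (v * sC)"
definition "XP = {w \<in> S. \<exists>l>0. T w = of_real l *\<^sub>C w}"
definition "XN = {w \<in> S. \<exists>l<0. T w = of_real l *\<^sub>C w}"
definition "P = Cvec.span XP"

lemma T_add: "T (v + w) = T v + T w"
  by (simp add: T_def distrib_right Cvec.scale_right_distrib)

lemma T_scale: "T (c *\<^sub>C v) = c *\<^sub>C T v"
  by (simp add: T_def scaleC_mult_left mult.commute)

lemma S_subspace: "Cvec.subspace S"
  by (auto simp: S_def Cvec.subspace_def distrib_left scaleC_mult_right)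

lemma S_mult: "v \<in> S \<Longrightarrow> v * x \<in> S" "v \<in> S \<Longrightarrow> x * v \<in> S"
  by (simp_all add: S_def mult.assoc[symmetric]) (simp add: u_central[of x] mult.assoc)

lemma T_S: "v \<in> S \<Longrightarrow> T v \<in> S"
  unfolding T_def by (intro Cvec.subspace_scale[OF S_subspace] S_mult)

lemma S_conjugate: "v \<in> S \<Longrightarrow> conjugate v \<in> S"
  using conjugate_mult[of u v] by (simp add: S_def conjugate_u)

lemma S_mult_zero: assumes "v \<in> S" "a \<in> A1 \<union> Am" shows "a * v = 0"
proof -
  have "a * v = a * (u * v)" using u_mult(2)[OF assms(2)] by (simp add: mult.assoc[symmetric])
  then show ?thesis using assms(1) by (simp add: S_def)
qed

text \<open>Since \<open>u\<close> fixes \<open>A1\<close> and \<open>Am\<close>, the outer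
  components of \<open>u * v = 0\<close> are those of \<open>v\<close>; hence \<open>S\<close> lies
  in \<open>A0\<close>.\<close>

lemma S_weil: assumes "v \<in> S" shows "weil v = - v"
proof -
  have "u * c1 v + u * c0 v + u * cm v = u * v"
    by (simp only: distrib_left[symmetric] components_sum[symmetric])
  then have "c1 v + u * c0 v + cm v = 0" using assms u_mult(1) by (simp add: S_def)
  moreover have "u * c0 v \<in> A0"
    using p_in_A0 conjugate_components(2)[OF p_in_A0] by (simp add: u_def Hdg_add mult_components)
  ultimately have "c1 v = 0" "cm v = 0"
    using components_eq(1,3)[of "c1 v" "u * c0 v" "cm v"] components_homogeneous(2)[of 0] by simp_all
  then show ?thesis using components_sum[of v] by (simp add: weil_def)
qed

lemma S_ip: "w \<in> S \<Longrightarrow> ip v w = - h v w"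
  by (simp add: ip_def S_weil)

text \<open>On \<open>S\<close> the form \<open>ip\<close> is \<open>- h\<close>; the sign from
  \<open>hat sC = - sC\<close> cancels the one from conjugating \<i>.\<close>

lemma T_selfadjoint: "v \<in> S \<Longrightarrow> w \<in> S \<Longrightarrow> ip (T v) w = ip v (T w)"
  using T_S[of w] by (simp add: S_ip T_def hermitian_form_simps h_adjoint(2) hat_sC)

lemma P_S: "w \<in> P \<Longrightarrow> w \<in> S"
  using Cvec.span_minimal[OF _ S_subspace, of XP] by (auto simp: P_def XP_def)

text \<open>Conjugation fixes \<open>sC\<close> and negates \<i>, so it reverses the sign of the
  eigenvalues of \<open>T\<close>.\<close>

lemma conjugate_XP: "conjugate ` XP = XN"
proof -
  have T: "T (conjugate w) = - conjugate (T w)" for w by (simp add: T_def)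
  have eig: "T (conjugate w) = of_real (- l) *\<^sub>C conjugate w" if "T w = of_real l *\<^sub>C w" for w l
    by (simp add: T that)
  have "conjugate w \<in> XN" if w: "w \<in> XP" for w
  proof -
    obtain l where "w \<in> S" "l > 0" "T w = of_real l *\<^sub>C w" using w by (auto simp: XP_def)
    then show ?thesis using S_conjugate eig[of w l] unfolding XN_def by (auto intro: exI[of _ "- l"])
  qed
  moreover have "conjugate w \<in> XP" if w: "w \<in> XN" for w
  proof -
    obtain l where "w \<in> S" "l < 0" "T w = of_real l *\<^sub>C w" using w by (auto simp: XN_def)
    then show ?thesis using S_conjugate eig[of w l] unfolding XP_def by (auto intro: exI[of _ "- l"])
  qed
  ultimately show ?thesis by (metis conjugate_conjugate image_eqI image_subset_iff subsetI subset_antisym)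
qed

lemma S_decomposition:
  assumes "v \<in> S"
  shows "\<exists>a\<in>P. \<exists>b\<in>P. v = a + conjugate b"
proof -
  have "S \<subseteq> Cvec.span {w \<in> S. \<exists>l. T w = of_real l *\<^sub>C w}"
    by (rule hs.spectral_decomposition[OF T_add T_scale S_subspace T_S T_selfadjoint])
  also have "\<dots> \<subseteq> Cvec.span (XP \<union> XN)"
  proof (rule Cvec.span_minimal)
    show "{w \<in> S. \<exists>l. T w = of_real l *\<^sub>C w} \<subseteq> Cvec.span (XP \<union> XN)"
    proof clarify
      fix w l assume w: "w \<in> S" "T w = of_real l *\<^sub>C w"
      consider "l > 0" | "l < 0" | "l = 0" by linarith
      then show "w \<in> Cvec.span (XP \<union> XN)"
      proof cases
        \<comment> \<open>Eigenvalue zero is excluded by injectivity of right multiplication by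
          \<open>sC\<close>.\<close>
        case 3
        then have "\<i> *\<^sub>C (w * sC) = 0" using w by (simp add: T_def)
        then have "w * sC = 0" by (simp only: Cvec.scale_eq_0_iff) simp
        then have "w = 0" by (rule mult_sC_injective)
        then show ?thesis by (simp add: Cvec.span_zero)
      qed (use w in \<open>auto simp: XP_def XN_def intro!: Cvec.span_base\<close>)
    qed
  qed simp
  finally have "v \<in> Cvec.span (XP \<union> XN)" using assms by auto
  moreover have "Cvec.span XN = conjugate ` P" by (simp add: P_def conjugate_span conjugate_XP)
  ultimately show ?thesis unfolding Cvec.span_Un P_def by auto
qed

section \<open>The polarization and the (1,0)-part\<close>

definition \<omega> where "\<omega> x y = form x (y * s)"
definition W where "W = {a + b | a b. p * a = a \<and> b \<in> P}"

lemma W_I: "p * a = a \<Longrightarrow> b \<in> P \<Longrightarrow> a + b \<in> W"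
  unfolding W_def by blast

lemma bilinear_\<omega>: "Q_bilinear_form \<omega>"
  using bilinear_form
  by (auto simp: Q_bilinear_form_def \<omega>_def Vector_Spaces.linear_iff distrib_right mult_scaleQ_left)

lemma \<omega>_skew: "\<omega> x y = - \<omega> y x"
proof -
  \<comment> \<open>Written as \<open>t (- s)\<close>, the factor \<open>s\<close> can be moved to
    the first argument.\<close>
  have "\<omega> x y = form x (y * t (- s))"
    using t_s t_involutive by (simp add: \<omega>_def) (metis)
  also have "\<dots> = form (x * (- s)) y" by (rule t_adjoint_right[symmetric])
  also have "\<dots> = - \<omega> y x"
  proof -
    have "Vector_Spaces.linear scaleQ (*) (form y)" using bilinear_form by (simp add: Q_bilinear_form_def)
    then interpret Vector_Spaces.linear scaleQ "(*)" "form y" .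
    show ?thesis by (simp add: \<omega>_def form_sym[of _ y] neg)
  qed
  finally show ?thesis .
qed

lemma extend_\<omega>: "extend_form \<omega> v w = h v (conjugate w * sC)"
proof -
  have "extend_form \<omega> v w = extend_form form v (w * sC)"
  proof (induction v rule: complexification_induct)
    case (tensor x c)
    show ?case
      by (induction w rule: complexification_induct)
         (simp_all add: extend_form_tensor[OF bilinear_\<omega>] extend_form_tensor[OF bilinear_form] tensor_times_tensor
            extend_form_add_right distrib_right, simp add: \<omega>_def)
  qed (simp add: extend_form_add_left)
  then show ?thesis by (simp add: hermitian_form_def)
qed

lemma extend_\<omega>_skew: "extend_form \<omega> v w = - extend_form \<omega> w v"
proof -
  have "\<omega> x y = (- 1) * \<omega> y x" for x y using \<omega>_skew[of x y] by simp
  from extend_form_swap[OF bilinear_\<omega> bilinear_\<omega> this, of v w] show ?thesis by simp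
qed

text \<open>\<open>u\<close> is self-adjoint, acts as the identity on \<open>v\<close> and kills
  \<open>w\<close>.\<close>

lemma S_h_zero: assumes "p * v = v" "w \<in> S" shows "h v w = 0" "h w v = 0"
proof -
  have "u * v = v" using assms(1) u_p by (metis mult.assoc)
  then have "h v w = h (u * v) w" by simp
  also have "\<dots> = 0" using assms(2) by (simp add: h_adjoint(1) hat_u S_def)
  finally show "h v w = 0" .
  then show "h w v = 0" using h_cnj[of v w] by simp
qed

text \<open>On eigenvectors with eigenvalues \<open>l\<close> and \<open>m\<close>, symmetry of
  \<open>form\<close> and skewness of \<open>\<omega>\<close> give \<open>(l + m) * F = 0\<close>
  for their pairing \<open>F\<close>, and \<open>l + m > 0\<close>.\<close>

lemma isotropic_P:
  assumes "v \<in> P" "w \<in> P"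
  shows "extend_form \<omega> v w = 0"
proof -
  have e0: "extend_form \<omega> 0 x = 0" "extend_form \<omega> x 0 = 0" for x
    using extend_form_add_left[of \<omega> 0 0 x] extend_form_add_right[of \<omega> x 0 0] by simp_all
  have gen: "extend_form \<omega> x y = 0" if xy: "x \<in> XP" "y \<in> XP" for x y
  proof -
    obtain l m where lm: "l > 0" "m > 0" "T x = of_real l *\<^sub>C x" "T y = of_real m *\<^sub>C y"
      using xy by (auto simp: XP_def)
    have ev: "z * sC = (- \<i> * of_real k) *\<^sub>C z" if "T z = of_real k *\<^sub>C z" for z k
    proof -
      have "z * sC = (- \<i>) *\<^sub>C T z" by (simp add: T_def)
      then show ?thesis using that by simp
    qed
    define F where "F = extend_form form x y"
    have F: "extend_form form y x = F"
      using extend_form_swap[OF bilinear_form bilinear_form, of 1 y x] form_sym by (simp add: F_def)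
    have f: "extend_form \<omega> v w = extend_form form v (w * sC)" for v w
      by (simp add: extend_\<omega> hermitian_form_def)
    have 1: "extend_form \<omega> x y = - \<i> * of_real m * F"
      by (simp only: f ev[OF lm(4)] extend_form_scale_right F_def)
    have 2: "extend_form \<omega> y x = - \<i> * of_real l * F"
      by (simp only: f ev[OF lm(3)] extend_form_scale_right F)
    have 3: "- \<i> * of_real m * F = - (- \<i> * of_real l * F)"
      using extend_\<omega>_skew[of x y] unfolding 1 2 .
    have "(\<i> * of_real (l + m)) * F = - (- \<i> * of_real l * F) - (- \<i> * of_real m * F)"
      by (simp add: algebra_simps)
    also have "\<dots> = 0" unfolding 3 by simp
    finally have "(\<i> * of_real (l + m)) * F = 0" .
    moreover have "\<i> * complex_of_real (l + m) \<noteq> 0" using lm by (simp del: of_real_add)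
    ultimately have "F = 0" by (simp only: mult_eq_0_iff) simp
    then show ?thesis by (simp add: 1)
  qed
  have gen': "extend_form \<omega> x w = 0" if "x \<in> XP" for x
    using assms(2) unfolding P_def
    by (induction rule: Cvec.span_induct_alt)
       (simp_all add: e0 extend_form_add_right extend_form_scale_right gen that)
  show ?thesis
    using assms(1) unfolding P_def
    by (induction rule: Cvec.span_induct_alt)
       (simp_all add: e0 extend_form_add_left extend_form_scale_left gen')
qed

text \<open>Moving the self-adjoint \<open>p\<close> across meets \<open>pb\<close> in
  \<open>conjugate w\<close>, and \<open>p * pb = 0\<close>.\<close>

lemma isotropic_p:
  assumes "p * v = v" "p * w = w"
  shows "extend_form \<omega> v w = 0"
proof -
  have "p * conjugate w = p * (pb * conjugate w)" using arg_cong[OF assms(2), of conjugate] by simp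
  then have z: "p * conjugate w = 0" by (simp add: mult.assoc[symmetric] p_mult_pb)
  have "extend_form \<omega> v w = h (p * v) (conjugate w * sC)" by (simp add: extend_\<omega> assms(1))
  also have "\<dots> = h v (p * conjugate w * sC)" by (simp add: h_adjoint(1) hat_p mult.assoc)
  finally show ?thesis by (simp add: z)
qed

lemma isotropic_W: assumes "v \<in> W" "w \<in> W" shows "extend_form \<omega> v w = 0"
proof -
  obtain a b c d where *: "v = a + b" "w = c + d" "p * a = a" "p * c = c" "b \<in> P" "d \<in> P"
    using assms by (auto simp: W_def)
  have mix: "extend_form \<omega> x y = 0" if "p * x = x" "y \<in> P" for x y
    unfolding extend_\<omega> using that by (intro S_h_zero S_mult S_conjugate P_S)
  have "extend_form \<omega> b c = 0" using extend_\<omega>_skew[of b c] mix[OF *(4,5)] by simp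
  then show ?thesis using * mix[OF *(3,6)] isotropic_p[OF *(3,4)] isotropic_P[OF *(5,6)]
    by (simp add: extend_form_add_left extend_form_add_right)
qed

text \<open>The two summands of \<open>W\<close> are orthogonal, so positivity is checked
  separately: the choice of \<open>s\<close> gives it on the first, the positive eigenvalues of
  \<open>T\<close> on \<open>P\<close>.\<close>

lemma positive_W:
  assumes "w \<in> W" "w \<noteq> 0"
  shows "\<i> * hermitian_form \<omega> w w \<in> \<real>" "0 < Re (\<i> * hermitian_form \<omega> w w)"
proof -
  have eq: "\<i> * hermitian_form \<omega> w w = \<i> * h w (w * sC)"
    by (simp add: hermitian_form_def[of \<omega>] extend_\<omega>)
  \<comment> \<open>Skewness of \<open>s\<close> makes this value purely imaginary.\<close>
  have "cnj (h w (w * sC)) = - h w (w * sC)" by (simp add: h_cnj h_adjoint(2) hat_sC)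
  then show "\<i> * hermitian_form \<omega> w w \<in> \<real>" unfolding eq
    by (simp add: complex_is_Real_iff complex_eq_iff)
  obtain a b where *: "w = a + b" "p * a = a" "b \<in> P" using assms(1) by (auto simp: W_def)
  have bS: "b \<in> S" "b * sC \<in> S" using *(3) P_S S_mult by auto
  have "h b (a * sC) = 0"
    by (rule S_h_zero(2)[OF _ bS(1)]) (simp add: mult.assoc[symmetric] *(2))
  then have "\<i> * h w (w * sC) = \<i> * h a (a * sC) + \<i> * h b (b * sC)"
    using S_h_zero(1)[OF *(2) bS(2)] by (simp add: *(1) distrib_right hermitian_form_simps distrib_left)
  moreover have "\<i> * h b (b * sC) = ip b (T b)"
    using T_S[OF bS(1)] by (simp add: S_ip T_def hermitian_form_simps)
  moreover have "0 < Re (ip b (T b))" if "b \<noteq> 0"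
    using hs.span_positive_eigenvectors_positive[OF T_add T_scale S_subspace T_selfadjoint, of b] *(3) that
    by (simp add: P_def XP_def)
  moreover have "0 < Re (\<i> * h a (a * sC))" if "a \<noteq> 0" using s_pos[OF that *(2)] .
  ultimately show "0 < Re (\<i> * hermitian_form \<omega> w w)"
    using assms(2) *(1) unfolding eq by (cases "a = 0"; cases "b = 0"; simp)
qed

lemma polarizes_W: "polarizes_1 W \<omega>"
  unfolding polarizes_1_def positive_definite_on_def
  using bilinear_\<omega> \<omega>_skew isotropic_W positive_W by blast

lemma subspace_W: "Cvec.subspace W"
proof -
  have "W = {x + y | x y. x \<in> {a. p * a = a} \<and> y \<in> P}" by (auto simp: W_def)
  moreover have "Cvec.subspace {a. p * a = a}"
    by (auto simp: Cvec.subspace_def distrib_left scaleC_mult_right)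
  ultimately show ?thesis using Cvec.subspace_sums[of "{a. p * a = a}" P] by (simp add: P_def)
qed

lemma hodge_W: "hodge_structure_1 W"
  unfolding hodge_structure_1_def
proof (intro conjI subspace_W allI)
  fix v
  \<comment> \<open>A nonzero \<open>x\<close> here would have a positive value of the polarization,
    which vanishes because \<open>x\<close> and its conjugate both lie in the isotropic
    \<open>W\<close>.\<close>
  have inter: "x = 0" if "x \<in> W" "x \<in> conjugate ` W" for x
  proof (rule ccontr)
    assume "x \<noteq> 0"
    then have "0 < Re (\<i> * hermitian_form \<omega> x x)" using that(1) by (intro positive_W)
    moreover have "conjugate x \<in> W" using that(2) by auto
    ultimately show False using isotropic_W[OF that(1)] by (simp add: hermitian_form_def)
  qed
  \<comment> \<open>Decompose \<open>v\<close> as \<open>p * v + pb * v\<close> plus a rest in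
    \<open>S\<close>, which splits into \<open>P\<close> and its conjugate.\<close>
  have "v - u * v \<in> S"
    by (simp add: S_def right_diff_distrib mult.assoc[symmetric])
       (simp add: u_def distrib_left distrib_right p_idem pb_idem p_mult_pb pb_mult_p)
  then obtain a b where ab: "a \<in> P" "b \<in> P" "v - u * v = a + conjugate b" using S_decomposition by blast
  have "p * v + a \<in> W" using ab(1) by (intro W_I) (simp_all add: mult.assoc[symmetric] p_idem)
  moreover have "pb * v + conjugate b \<in> conjugate ` W"
  proof -
    have "p * conjugate v + b \<in> W" using ab(2) by (intro W_I) (simp_all add: mult.assoc[symmetric] p_idem)
    then show ?thesis by (rule rev_image_eqI) simp
  qed
  moreover have "v = (p * v + a) + (pb * v + conjugate b)"
    using ab(3) by (simp add: u_def distrib_right algebra_simps)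
  ultimately obtain x y where xy: "x \<in> W" "y \<in> conjugate ` W" "v = x + y" by blast
  show "\<exists>!(a, b). a \<in> W \<and> b \<in> conjugate ` W \<and> v = a + b"
  proof (rule ex1I[of _ "(x, y)"], use xy in simp, clarify)
    fix x' y' assume x': "x' \<in> W" "y' \<in> W" "v = x' + conjugate y'"
    obtain z where z: "z \<in> W" "y = conjugate z" using xy(2) by blast
    have "x - x' \<in> W" using subspace_W xy(1) x'(1) by (rule Cvec.subspace_diff)
    moreover have "x - x' = conjugate (y' - z)"
      using xy(3) x'(3) z(2) by (simp add: algebra_simps)
    then have "x - x' \<in> conjugate ` W" using Cvec.subspace_diff[OF subspace_W x'(2) z(1)] by blast
    ultimately have "x - x' = 0" by (rule inter)
    then show "x' = x \<and> conjugate y' = y" using xy(3) x'(3) by simp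
  qed
qed

section \<open>Compatibility with left multiplication\<close>

lemma A0_W: assumes "v \<in> A0" "w \<in> W" shows "v * w \<in> W"
proof -
  obtain a b where *: "w = a + b" "p * a = a" "b \<in> P" using assms(2) by (auto simp: W_def)
  have "p * (v * a) = v * a"
    using p_commute_A0[OF assms(1)] *(2) by (metis mult.assoc)
  moreover have "v * b \<in> P"
    using *(3) unfolding P_def
  proof (induction rule: Cvec.span_induct_alt)
    case base show ?case by (simp add: Cvec.span_zero)
  next
    case (step c x y)
    then obtain l where "x \<in> S" "l > 0" "T x = of_real l *\<^sub>C x" by (auto simp: XP_def)
    \<comment> \<open>Left multiplication commutes with right multiplication by \<open>sC\<close>
      and so preserves the eigenspaces of \<open>T\<close>.\<close>
    moreover have "T (v * x) = v * T x" by (simp add: T_def scaleC_mult_right mult.assoc)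
    ultimately have "v * x \<in> XP" by (auto simp: XP_def S_mult scaleC_mult_right)
    then show ?case using step
      by (simp add: distrib_left scaleC_mult_right Cvec.span_add Cvec.span_scale Cvec.span_base)
  qed
  ultimately show ?thesis by (auto simp: W_def *(1) distrib_left)
qed

text \<open>Elements of degree 1 kill \<open>S\<close>, hence \<open>P\<close> and its conjugate;
  what remains follows from \<open>v * p = 0\<close> and \<open>p * v = v\<close>.\<close>

lemma A1_W: assumes "v \<in> A1" "w \<in> W" shows "v * w = 0" "v * conjugate w \<in> W"
proof -
  obtain a b where *: "w = a + b" "p * a = a" "b \<in> P" using assms(2) by (auto simp: W_def)
  have b: "v * b = 0" "v * conjugate b = 0"
    using S_mult_zero S_conjugate P_S *(3) assms(1) by blast+
  have "v * a = v * p * a" using *(2) by (simp add: mult.assoc)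
  then show "v * w = 0" by (simp add: *(1) distrib_left b A1_mult_p[OF assms(1)])
  have "p * (v * conjugate a) = v * conjugate a"
    by (simp add: mult.assoc[symmetric] p_mult_A1[OF assms(1)])
  moreover have "0 \<in> P" by (simp add: P_def Cvec.span_zero)
  ultimately show "v * conjugate w \<in> W"
    using W_I[of "v * conjugate a" 0] by (simp add: *(1) distrib_left b)
qed

lemma morphism_W: "left_mult_hodge_morphism Hdg W"
  unfolding left_mult_hodge_morphism_def
proof (intro allI ballI)
  fix i j v assume v: "v \<in> Hdg i j"
  have lin: "Vector_Spaces.linear scaleC scaleC (\<lambda>w. v * w)"
    by unfold_locales (simp_all add: distrib_left scaleC_mult_right)
  \<comment> \<open>Reduces the action on the conjugate of \<open>W\<close> to that of
    \<open>conjugate v\<close> on \<open>W\<close>; in particular degree -1 follows from degree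
    1.\<close>
  have conj: "v * conjugate w = conjugate (conjugate v * w)" for w by simp
  consider "(i, j) = (2, 0)" | "(i, j) = (1, 1)" | "(i, j) = (0, 2)" | "(i, j) \<notin> {(2, 0), (1, 1), (0, 2)}"
    by blast
  then show "(\<lambda>w. v * w) \<in> Hom_hodge W i j"
  proof cases
    case 1
    then show ?thesis using v A1_W lin by (auto simp: Hom_hodge_def)
  next
    case 2
    then have v: "v \<in> A0" using v by simp
    then have "conjugate v \<in> A0" by (rule conjugate_components)
    then have "v * conjugate w \<in> conjugate ` W" if "w \<in> W" for w
      unfolding conj using A0_W that by blast
    then show ?thesis using 2 v A0_W lin by (auto simp: Hom_hodge_def)
  next
    case 3
    then have v: "v \<in> Am" using v by simp
    then have cv: "conjugate v \<in> A1" by (rule conjugate_components)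
    have "v * w \<in> conjugate ` W" if "w \<in> W" for w
      using A1_W(2)[OF cv that] by (rule rev_image_eqI) simp
    moreover have "v * conjugate w = 0" if "w \<in> W" for w
      unfolding conj A1_W(1)[OF cv that] by simp
    ultimately show ?thesis using 3 lin by (auto simp: Hom_hodge_def)
  next
    case 4
    then have "v = 0" using v Hdg_trivial by blast
    then show ?thesis using 4 lin by (auto simp: Hom_hodge_def)
  qed
qed

end

theorem theorem2:
  fixes Hdg :: "int \<Rightarrow> int \<Rightarrow> 'h::rat_algebra_1 complexification set"
    and form :: "'h \<Rightarrow> 'h \<Rightarrow> rat"
    and t :: "'h \<Rightarrow> 'h"
  assumes finite_dim: "\<exists>B::'h set. finite B \<and> Qvec.span B = UNIV"
    and hodge: "hodge_structure_2 Hdg"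
    and polarization: "polarizes_2 Hdg form"
    and H20_nonzero: "Hdg 2 0 \<noteq> {0}"
    and product: "product_has_bidegree_minus_one Hdg"
    and t_linear: "Vector_Spaces.linear scaleQ scaleQ t"
    and t_involutive: "\<And>x. t (t x) = x"
    and t_adjoint_left: "\<And>a x y. form (a * x) y = form x (t a * y)"
    and t_adjoint_right: "\<And>a x y. form (x * a) y = form x (y * t a)"
    and center_field: "number_field {z \<in> center. t z = z}"
  shows "\<exists>W \<omega>. hodge_structure_1 W \<and> polarizes_1 W \<omega> \<and> left_mult_hodge_morphism Hdg W"
proof -
  obtain D :: "'h set" where D: "finite D" "Qvec.span D = UNIV" using finite_dim by blast
  obtain B where B: "B \<subseteq> D" "Qvec.independent B" "D \<subseteq> Qvec.span B"
    using Qvec.basis_exists[of D] by metis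
  have fB: "finite B" using B(1) D(1) by (rule finite_subset)
  have sB: "Qvec.span B = UNIV" using Qvec.span_minimal[OF B(3) Qvec.subspace_span] D(2) by auto
  interpret hodge_algebra B Hdg form t
    by (intro hodge_algebra.intro rat_basis.intro hodge_algebra_axioms.intro) (fact fB sB B(2) assms)+
  obtain s where s: "t s = - s" "\<And>w. w \<noteq> 0 \<Longrightarrow> p * w = w \<Longrightarrow> 0 < Re (\<i> * h w (w * (s \<otimes>\<^sub>C 1)))"
    using exists_skew_positive by blast
  interpret hodge_algebra_field B Hdg form t s
    by (intro hodge_algebra_field.intro hodge_algebra_field_axioms.intro)
       (fact hodge_algebra_axioms H20_nonzero center_field s)+
  show ?thesis using hodge_W polarizes_W morphism_W by blast
qed

end
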